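(* The set $X(T,E)\cup\{0\}$ contains an $\mathbb{F}$-vector subspace of $H(T,E)$ which is dense in $H(T,E)$.
   Context: Convention: $\mathbb{N}=\{1,2,3,\dots\}$. Tree. $T$ is the vertex set of a rooted tree with root $x_0$; $T_0=\{x_0\}$ and, for $n\in\mathbb{N}$, $T_n$ is the set of vertices at distance $n$ from $x_0$. For $x\in T$, $S(x)$ is the set of children of $x$. Each $T_n$ is finite and each $S(x)$ has at least two elements. For all $x\in T$, $y\in S(x)$ a real number $q(x,y)>0$ is given with $\sum_{y\in S(x)}q(x,y)=1$ for all $x \in T$. Boundary and measure. $\partial T$ is the set of all infinite geodesics starting at $x_0$, i.e. sets $e=\{z_n:n\in\mathbb{N}\}\subseteq T$ with $z_1=x_0$ and $z_{n+1}\in S(z_n)$ for all $n \in \mathbb{N}$. For $x\in T$, $B_x=\{e\in\partial T: x\in e\}$. For $x\in T_n$, $n\ge 1$, $p(B_x)=\prod_{j=0}^{n-1}q(y_j,y_{j+1})$, where $y_0=x_0$, $y_n=x$, $y_{j+1}\in S(y_j)$ for $0\le j\le n-1$. $\mathcal{M}_n$ is the $\sigma$-algebra on $\partial T$ generated by $\{B_x:x\in T_n\}$, and $\mathbb{P}_n$ is the probability measure on $\mathcal{M}_n$ extending $p$. $\mathbb{P}$ is the complete probability measure on $(\partial T,\mathcal{M})$ with $\mathbb{P}|_{\mathcal{M}_n}=\mathbb{P}_n$ for all $n$, where $\mathcal{M}$ is the completion of the $\sigma$-algebra generated by $\bigcup_{n\ge1}\mathcal{M}_n$ (it exists by Kolmogorov's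 consistency theorem). Values. $\mathbb{F}$ is a field endowed with a metric for which addition, multiplication and the inverse function are continuous. $E$ is a separable topological vector space over $\mathbb{F}$ (addition and scalar multiplication are continuous), metrizable by a translation invariant metric $d$. $L^0(\partial T,E)$ is the space of $\mathcal{M}$-measurable functions $\partial T\to E$ (preimages of open sets lie in $\mathcal{M}$), identified when equal $\mathbb{P}$-almost everywhere, with the topology of convergence in probability, induced by the metric $P(\psi,\phi)=\int_{\partial T}\frac{d(\psi(e),\phi(e))}{1+d(\psi(e),\phi(e))}\,d\mathbb{P}(e)$. Harmonic functions. For all $x\in T$, $y\in S(x)$ a scalar $w(x,y)\in\mathbb{F}\setminus\{0\}$ is fixed, with $\sum_{y\in S(x)}w(x,y)=1$ for all $x\in T$. A function $f:T\to E$ is (generalized) harmonic if $f(x)=\sum_{y\in S(x)}w(x,y)f(y)$ for all $x\in T$. $H(T,E)$ is the set of harmonic functions, with the topology of pointwise convergence on $T$ and pointwise vector space operations. For $f\in H(T,E)$, $n\in\mathbb{N}$, the $\mathcal{M}$-measurable function $\omega_n(f):\partial T\to E$ is given by $\omega_n(f)(e)=f(z)$, where $z$ is the unique element of $e\cap T_n$. The class $X(T,E)$. The upper density of $A\subseteq\mathbb{N}$ is $\limsup_{N\to\infty}\frac{|A\cap\{1,\dots,N\}|}{N}$. $X(T,E)$ is the set of $f\in H(T,E)$ such that for every nonempty open $V\subseteq L^0(\partial T,E)$ the set $\{n\in\mathbb{N}:\omega_n(f)\in V\}$ has upper density equal to one. *)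

theory Defs
  imports "HOL-Probability.Probability" "HOL-Library.Function_Algebras"
begin

section \<open>Rooted trees\<close>

text \<open>The vertex set of the tree is the whole type \<open>'v\<close>; the edges are given by the adjacency
  relation. A tree is a simple graph in which any two vertices are joined by exactly one path.\<close>

definition tree :: "('v \<Rightarrow> 'v \<Rightarrow> bool) \<Rightarrow> bool" where
  "tree adj \<longleftrightarrow> symp adj \<and> irreflp adj \<and>
     (\<forall>x y. \<exists>!p. p \<noteq> [] \<and> hd p = x \<and> last p = y \<and> distinct p \<and> successively adj p)"

definition gdist :: "('v \<Rightarrow> 'v \<Rightarrow> bool) \<Rightarrow> 'v \<Rightarrow> 'v \<Rightarrow> nat" where
  "gdist adj x y = (LEAST n. (adj ^^ n) x y)"

definition level :: "('v \<Rightarrow> 'v \<Rightarrow> bool) \<Rightarrow> 'v \<Rightarrow> nat \<Rightarrow> 'v set" where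
  "level adj r n = {x. gdist adj r x = n}"

definition children :: "('v \<Rightarrow> 'v \<Rightarrow> bool) \<Rightarrow> 'v \<Rightarrow> 'v \<Rightarrow> 'v set" where
  "children adj r x = {y. adj x y \<and> gdist adj r y = Suc (gdist adj r x)}"

definition transition_tree :: "('v \<Rightarrow> 'v \<Rightarrow> bool) \<Rightarrow> 'v \<Rightarrow> ('v \<Rightarrow> 'v \<Rightarrow> real) \<Rightarrow> bool" where
  "transition_tree adj r q \<longleftrightarrow> tree adj \<and>
     (\<forall>n. finite (level adj r n)) \<and>
     (\<forall>x. 2 \<le> card (children adj r x)) \<and>
     (\<forall>x. \<forall>y\<in>children adj r x. 0 < q x y) \<and>
     (\<forall>x. (\<Sum>y\<in>children adj r x. q x y) = 1)"


section \<open>The boundary and its probability measure\<close>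

text \<open>Geodesics are indexed from 0, so that their \<open>n\<close>-th vertex lies in level \<open>n\<close>.\<close>

definition boundary :: "('v \<Rightarrow> 'v \<Rightarrow> bool) \<Rightarrow> 'v \<Rightarrow> 'v set set" where
  "boundary adj r = {range z |z. z 0 = r \<and> (\<forall>n. z (Suc n) \<in> children adj r (z n))}"

definition cylinder :: "('v \<Rightarrow> 'v \<Rightarrow> bool) \<Rightarrow> 'v \<Rightarrow> 'v \<Rightarrow> 'v set set" where
  "cylinder adj r x = {e \<in> boundary adj r. x \<in> e}"

definition level_algebra :: "('v \<Rightarrow> 'v \<Rightarrow> bool) \<Rightarrow> 'v \<Rightarrow> nat \<Rightarrow> 'v set set set" where
  "level_algebra adj r n = sigma_sets (boundary adj r) (cylinder adj r ` level adj r n)"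

text \<open>The last condition on \<open>Q\<close> says that its restriction to \<open>level_algebra adj r n\<close> is the
  probability measure determined by the products of the weights \<open>q\<close> along the geodesic from the
  root to a vertex of level \<open>n\<close>.\<close>

definition boundary_measure ::
  "('v \<Rightarrow> 'v \<Rightarrow> bool) \<Rightarrow> 'v \<Rightarrow> ('v \<Rightarrow> 'v \<Rightarrow> real) \<Rightarrow> 'v set measure \<Rightarrow> bool" where
  "boundary_measure adj r q P \<longleftrightarrow> (\<exists>Q. P = completion Q \<and> prob_space Q \<and>
     space Q = boundary adj r \<and>
     sets Q = sigma_sets (boundary adj r) (\<Union>n\<in>{1..}. level_algebra adj r n) \<and>
     (\<forall>n\<ge>1. \<forall>y. y 0 = r \<and> (\<forall>j<n. y (Suc j) \<in> children adj r (y j)) \<longrightarrow>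
        measure Q (cylinder adj r (y n)) = (\<Prod>j<n. q (y j) (y (Suc j)))))"


section \<open>The space of values\<close>

text \<open>The sorts provide the continuity of addition and multiplication in the field \<open>'f\<close> and of
  addition in \<open>'e\<close>. They also ask for continuity of negation, which is automatic here, since it is
  multiplication by \<open>-1\<close>.\<close>

definition separable_metrizable_tvs ::
  "('f::{field,metric_space,topological_ab_group_add,topological_semigroup_mult} \<Rightarrow>
    'e::{metric_space,topological_ab_group_add} \<Rightarrow> 'e) \<Rightarrow> bool" where
  "separable_metrizable_tvs smul \<longleftrightarrow> vector_space smul \<and>
     continuous_on (- {0}) (inverse :: 'f \<Rightarrow> 'f) \<and>
     continuous_on UNIV (\<lambda>(a, x). smul a x) \<and>
     (\<forall>x y z :: 'e. dist (x + z) (y + z) = dist x y) \<and>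
     separable_space (euclidean :: 'e topology)"


section \<open>The space \<open>L\<^sup>0\<close>\<close>

definition L0_class :: "'a measure \<Rightarrow> ('a \<Rightarrow> 'e::metric_space) \<Rightarrow> ('a \<Rightarrow> 'e) set" where
  "L0_class P \<phi> = {\<psi> \<in> borel_measurable P. AE e in P. \<phi> e = \<psi> e}"

definition L0 :: "'a measure \<Rightarrow> ('a \<Rightarrow> 'e::metric_space) set set" where
  "L0 P = L0_class P ` borel_measurable P"

text \<open>The integral does not depend on the representatives selected.\<close>

definition L0_dist :: "'a measure \<Rightarrow> ('a \<Rightarrow> 'e::metric_space) set \<Rightarrow> ('a \<Rightarrow> 'e) set \<Rightarrow> real" where
  "L0_dist P A B = (let \<psi> = SOME \<psi>. \<psi> \<in> A; \<phi> = SOME \<phi>. \<phi> \<in> B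
     in \<integral>e. dist (\<psi> e) (\<phi> e) / (1 + dist (\<psi> e) (\<phi> e)) \<partial>P)"

definition L0_topology :: "'a measure \<Rightarrow> ('a \<Rightarrow> 'e::metric_space) set topology" where
  "L0_topology P = Metric_space.mtopology (L0 P) (L0_dist P)"


section \<open>Harmonic functions\<close>

definition harmonic_weights ::
  "('v \<Rightarrow> 'v \<Rightarrow> bool) \<Rightarrow> 'v \<Rightarrow> ('v \<Rightarrow> 'v \<Rightarrow> 'f::field) \<Rightarrow> bool" where
  "harmonic_weights adj r w \<longleftrightarrow>
     (\<forall>x. \<forall>y\<in>children adj r x. w x y \<noteq> 0) \<and>
     (\<forall>x. (\<Sum>y\<in>children adj r x. w x y) = 1)"

definition harmonic_functions ::
  "('v \<Rightarrow> 'v \<Rightarrow> bool) \<Rightarrow> 'v \<Rightarrow> ('v \<Rightarrow> 'v \<Rightarrow> 'f) \<Rightarrow> ('f \<Rightarrow> 'e \<Rightarrow> 'e) \<Rightarrow>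
   ('v \<Rightarrow> 'e::comm_monoid_add) set" where
  "harmonic_functions adj r w smul =
     {f. \<forall>x. f x = (\<Sum>y\<in>children adj r x. smul (w x y) (f y))}"

definition boundary_trace ::
  "('v \<Rightarrow> 'v \<Rightarrow> bool) \<Rightarrow> 'v \<Rightarrow> nat \<Rightarrow> ('v \<Rightarrow> 'e) \<Rightarrow> 'v set \<Rightarrow> 'e" where
  "boundary_trace adj r n f e = f (THE z. z \<in> e \<inter> level adj r n)"

definition upper_density :: "nat set \<Rightarrow> ereal" where
  "upper_density A = limsup (\<lambda>N. ereal (real (card (A \<inter> {1..N})) / real N))"

definition frequently_universal ::
  "('v \<Rightarrow> 'v \<Rightarrow> bool) \<Rightarrow> 'v \<Rightarrow> ('v \<Rightarrow> 'v \<Rightarrow> 'f) \<Rightarrow> ('f \<Rightarrow> 'e \<Rightarrow> 'e) \<Rightarrow> 'v set measure \<Rightarrow>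
   ('v \<Rightarrow> 'e::{comm_monoid_add,metric_space}) set" where
  "frequently_universal adj r w smul P =
     {f \<in> harmonic_functions adj r w smul.
        \<forall>V. openin (L0_topology P) V \<and> V \<noteq> {} \<longrightarrow>
          upper_density {n. 1 \<le> n \<and> L0_class P (boundary_trace adj r n f) \<in> V} = 1}"

end

theory Submission
  imports Defs
begin

text \<open>
  Fix at every vertex \<open>x\<close> a light child, one with \<open>q x y \<le> 1/2\<close>. Values prescribed off the light
  children extend uniquely to a harmonic function, since the value at a light child is obtained by
  solving the harmonicity equation at its parent. If the prescription is constant along descendants
  below some level, the harmonic function takes the prescribed value everywhere except on the
  iterated light children of that level, whose cylinders have total mass at most \<open>(1/2) ^ k\<close> after
  \<open>k\<close> levels; as the weights sum to 1, a value once taken is kept.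

  The levels are cut into stages whose lengths grow so fast that a single stage dominates the count
  of all levels up to its end. In each stage exactly one member of a sequence of harmonic functions
  is steered to a prescribed step function and all others to 0. A linear combination in which that
  member has coefficient \<open>a \<noteq> 0\<close> is therefore close in probability to \<open>a\<close> times the step function
  during most of the stage. Letting the first levels of the sequence run through a dense set makes
  its span dense.
\<close>

section \<open>Levels, parents and ancestors\<close>

locale rooted_tree =
  fixes adj :: "'v \<Rightarrow> 'v \<Rightarrow> bool" and r :: 'v
  assumes tree: "tree adj"
begin

abbreviation depth :: "'v \<Rightarrow> nat" where
  "depth \<equiv> gdist adj r"

text \<open>The path supplied by the tree property is a walk from the root, so the
  \<open>LEAST\<close> in \<open>gdist\<close> ranges over a nonempty set and \<open>depth\<close>
  is attained.\<close>

lemma ex_relpowp: "\<exists>n. (adj ^^ n) r x"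
proof -
  obtain p where p: "p \<noteq> []" "hd p = r" "last p = x" "successively adj p"
    using tree unfolding tree_def by meson
  have "adj\<^sup>*\<^sup>* (hd p) (last p)" if "p \<noteq> []" "successively adj p" for p
    using that
  proof (induction p)
    case (Cons a p)
    then show ?case
      by (cases "p = []") (auto simp: successively_Cons intro: converse_rtranclp_into_rtranclp)
  qed simp
  with p have "adj\<^sup>*\<^sup>* r x" by blast
  then show ?thesis by (simp add: rtranclp_power)
qed

lemma relpowp_depth: "(adj ^^ depth x) r x"
  unfolding gdist_def using ex_relpowp by (rule LeastI_ex)

lemma depth_le: "(adj ^^ n) r x \<Longrightarrow> depth x \<le> n"
  unfolding gdist_def by (rule Least_le)

lemma depth_root [simp]: "depth r = 0"
  using depth_le[of 0 r] by simp

lemma depth_eq_0_iff: "depth x = 0 \<longleftrightarrow> x = r"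
  using relpowp_depth[of x] by auto

lemma ex_parent:
  assumes "depth y = Suc n"
  obtains x where "depth x = n" "y \<in> children adj r x"
proof -
  from relpowp_depth[of y] assms obtain x where x: "(adj ^^ n) r x" "adj x y"
    by auto
  then have "depth y \<le> Suc (depth x)"
    using relpowp_depth[of x] by (intro depth_le) auto
  with depth_le[OF x(1)] assms have "depth x = n" by simp
  with x assms that show thesis by (auto simp: children_def)
qed

text \<open>The depth bound along the path keeps a new child off it, so distinctness survives when
  the child is appended.\<close>

lemma ex_path:
  "\<exists>p. p \<noteq> [] \<and> hd p = r \<and> last p = x \<and> distinct p \<and> successively adj p \<and>
       (\<forall>v\<in>set p. depth v \<le> depth x)"
proof (induction "depth x" arbitrary: x)
  case 0
  then have "x = r" by (simp add: depth_eq_0_iff)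
  then show ?case by (intro exI[of _ "[r]"]) simp
next
  case (Suc n)
  then obtain z where z: "depth z = n" "x \<in> children adj r z"
    using ex_parent by metis
  with Suc(1)[of z] obtain p where p: "p \<noteq> []" "hd p = r" "last p = z" "distinct p"
    "successively adj p" "\<forall>v\<in>set p. depth v \<le> n"
    by auto
  with z Suc(2) have "x \<notin> set p" by fastforce
  with p z Suc(2) show ?case
    by (intro exI[of _ "p @ [x]"]) (auto simp: successively_append_iff children_def)
qed

text \<open>Two parents would yield two simple paths from the root to \<open>y\<close> that differ
  in the last vertex but one.\<close>

lemma parent_unique:
  assumes "y \<in> children adj r x" "y \<in> children adj r x'"
  shows "x = x'"
proof -
  have *: "\<exists>p. p \<noteq> [] \<and> last p = x \<and> p @ [y] \<noteq> [] \<and> hd (p @ [y]) = r \<and> last (p @ [y]) = y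
      \<and> distinct (p @ [y]) \<and> successively adj (p @ [y])"
    if "y \<in> children adj r x" for x
  proof -
    from ex_path[of x] obtain p where p: "p \<noteq> []" "hd p = r" "last p = x" "distinct p"
      "successively adj p" "\<forall>v\<in>set p. depth v \<le> depth x"
      by auto
    with that have "y \<notin> set p" by (fastforce simp: children_def)
    with p that show ?thesis
      by (intro exI[of _ p]) (auto simp: successively_append_iff children_def)
  qed
  obtain p p' where p: "p \<noteq> []" "last p = x" "p' \<noteq> []" "last p' = x'"
    "p @ [y] \<noteq> [] \<and> hd (p @ [y]) = r \<and> last (p @ [y]) = y
      \<and> distinct (p @ [y]) \<and> successively adj (p @ [y])"
    "p' @ [y] \<noteq> [] \<and> hd (p' @ [y]) = r \<and> last (p' @ [y]) = y
      \<and> distinct (p' @ [y]) \<and> successively adj (p' @ [y])"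
    using *[OF assms(1)] *[OF assms(2)] by blast
  from tree have "\<exists>!p. p \<noteq> [] \<and> hd p = r \<and> last p = y \<and> distinct p \<and> successively adj p"
    unfolding tree_def by blast
  with p(5,6) have "p @ [y] = p' @ [y]" by blast
  with p show ?thesis by simp
qed

section \<open>Parents, ancestors and functions constant below a level\<close>

lemma depth_child [simp]: "y \<in> children adj r x \<Longrightarrow> depth y = Suc (depth x)"
  by (simp add: children_def)

text \<open>The root is nobody's child and its value is unspecified; later uses are at vertices of
  positive depth.\<close>

definition parent :: "'v \<Rightarrow> 'v" where
  "parent y = (THE x. y \<in> children adj r x)"

lemma parent_child [simp]: "y \<in> children adj r x \<Longrightarrow> parent y = x"
  unfolding parent_def using parent_unique by blast

lemma child_parent: "depth y = Suc n \<Longrightarrow> y \<in> children adj r (parent y)"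
  using ex_parent parent_child by metis

text \<open>For \<open>depth y < p\<close> the truncated difference makes \<open>y\<close> its own ancestor.\<close>

definition ancestor :: "nat \<Rightarrow> 'v \<Rightarrow> 'v" where
  "ancestor p y = (parent ^^ (depth y - p)) y"

lemma ancestor_self: "depth y \<le> p \<Longrightarrow> ancestor p y = y"
  by (simp add: ancestor_def)

lemma ancestor_child: "y \<in> children adj r x \<Longrightarrow> p \<le> depth x \<Longrightarrow> ancestor p y = ancestor p x"
  by (simp add: ancestor_def Suc_diff_le funpow_swap1)

lemma depth_ancestor: "depth (ancestor p y) = min (depth y) p"
proof (induction "depth y" arbitrary: y)
  case 0
  then show ?case by (simp add: ancestor_self)
next
  case (Suc n)
  then obtain x where x: "depth x = n" "y \<in> children adj r x"
    using ex_parent by metis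
  show ?case
  proof (cases "depth y \<le> p")
    case False
    have "depth (ancestor p x) = min (depth x) p" using Suc(1) x(1) by simp
    moreover have "ancestor p y = ancestor p x" using False x by (intro ancestor_child) simp_all
    ultimately show ?thesis using False x by simp
  qed (simp add: ancestor_self)
qed

text \<open>Such a function keeps one value along a geodesic from level \<open>p\<close> on. It
  encodes a step function on the boundary that can be read off at any later level.\<close>

definition constant_below :: "nat \<Rightarrow> ('v \<Rightarrow> 'c) \<Rightarrow> bool" where
  "constant_below p v \<longleftrightarrow> (\<forall>x. p \<le> depth x \<longrightarrow> (\<forall>y\<in>children adj r x. v y = v x))"

lemma constant_below_ancestor: "constant_below p (\<lambda>y. c (ancestor p y))"
  by (simp add: constant_below_def ancestor_child)

lemma constant_below_mono: "constant_below p v \<Longrightarrow> p \<le> m \<Longrightarrow> constant_below m v"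
  by (simp add: constant_below_def)

section \<open>Boundary points as rays and the vertex at a level\<close>

definition ray :: "(nat \<Rightarrow> 'v) \<Rightarrow> bool" where
  "ray z \<longleftrightarrow> z 0 = r \<and> (\<forall>n. z (Suc n) \<in> children adj r (z n))"

lemma ray_child: "ray z \<Longrightarrow> z (Suc n) \<in> children adj r (z n)"
  by (simp add: ray_def)

lemma boundary_eq: "boundary adj r = range ` Collect ray"
  unfolding boundary_def ray_def[symmetric] by blast

lemma boundaryE:
  assumes "e \<in> boundary adj r"
  obtains z where "ray z" "e = range z"
  using assms by (auto simp: boundary_eq)

lemma depth_ray: "ray z \<Longrightarrow> depth (z n) = n"
proof (induction n)
  case (Suc n)
  then show ?case using depth_child[OF ray_child, of z n] by simp
qed (simp add: ray_def)

lemma ancestor_ray: "ray z \<Longrightarrow> ancestor p (z n) = z (min n p)"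
proof (induction n)
  case 0
  then show ?case by (simp add: ancestor_self depth_ray)
next
  case (Suc n)
  show ?case
  proof (cases "Suc n \<le> p")
    case False
    have "ancestor p (z (Suc n)) = ancestor p (z n)"
      using False depth_ray[OF Suc.prems, of n]
      by (intro ancestor_child[OF ray_child[OF Suc.prems]]) simp
    also have "\<dots> = z (min n p)" by (rule Suc.IH[OF Suc.prems])
    also have "min n p = min (Suc n) p" using False by simp
    finally show ?thesis .
  qed (simp add: ancestor_self depth_ray Suc)
qed

definition vertex_at :: "nat \<Rightarrow> 'v set \<Rightarrow> 'v" where
  "vertex_at n e = (THE z. z \<in> e \<inter> level adj r n)"

lemma vertex_at_ray [simp]: "ray z \<Longrightarrow> vertex_at n (range z) = z n"
  unfolding vertex_at_def by (rule the_equality) (auto simp: level_def depth_ray)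

lemma boundary_trace_eq: "boundary_trace adj r n f = (\<lambda>e. f (vertex_at n e))"
  by (simp add: boundary_trace_def vertex_at_def fun_eq_iff)

lemma depth_vertex_at [simp]: "e \<in> boundary adj r \<Longrightarrow> depth (vertex_at n e) = n"
  by (auto simp: boundary_eq depth_ray)

text \<open>A ray meets each level exactly once, so it can pass through \<open>x\<close> only at
  index \<open>depth x\<close>. This presents cylinders as point fibres of
  \<open>vertex_at\<close>.\<close>

lemma cylinder_eq:
  "cylinder adj r x = {e \<in> boundary adj r. vertex_at (depth x) e = x}"
proof -
  have *: "x \<in> range z \<longleftrightarrow> z (depth x) = x" if "ray z" for z
  proof
    assume "x \<in> range z"
    then obtain k where "x = z k" by blast
    with depth_ray[OF that] show "z (depth x) = x" by simp
  next
    assume "z (depth x) = x"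
    then show "x \<in> range z" by (rule range_eqI[OF sym])
  qed
  have "x \<in> e \<longleftrightarrow> vertex_at (depth x) e = x" if "e \<in> boundary adj r" for e
  proof -
    from that obtain z where "ray z" "e = range z" by (rule boundaryE)
    with * show ?thesis by simp
  qed
  then show ?thesis by (auto simp: cylinder_def)
qed

lemma ancestor_vertex_at:
  "e \<in> boundary adj r \<Longrightarrow> p \<le> n \<Longrightarrow> ancestor p (vertex_at n e) = vertex_at p e"
  by (erule boundaryE) (simp add: ancestor_ray min_def)

end

section \<open>Light children\<close>

locale probability_tree = rooted_tree adj r
  for adj :: "'v \<Rightarrow> 'v \<Rightarrow> bool" and r :: 'v +
  fixes q :: "'v \<Rightarrow> 'v \<Rightarrow> real"
  assumes transition: "transition_tree adj r q"
begin

lemma finite_level: "finite (level adj r n)"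
  using transition by (simp add: transition_tree_def)

lemma finite_children: "finite (children adj r x)"
  by (rule finite_subset[OF _ finite_level[of "Suc (depth x)"]]) (auto simp: level_def)

lemma finite_depth_le: "finite {y. depth y \<le> n}"
proof (rule finite_subset)
  show "{y. depth y \<le> n} \<subseteq> (\<Union>m\<le>n. level adj r m)" by (auto simp: level_def)
qed (simp add: finite_level)

text \<open>If all children weighed more than 1/2, two of them would already exceed the total weight
  1.\<close>

lemma ex_light_child: "\<exists>y\<in>children adj r x. q x y \<le> 1/2"
proof (rule ccontr)
  assume "\<not> ?thesis"
  then have *: "y \<in> children adj r x \<Longrightarrow> 1/2 < q x y" for y by force
  have card: "2 \<le> card (children adj r x)"
    using transition by (simp add: transition_tree_def)
  have "1 \<le> real (card (children adj r x)) * (1/2)"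
    using card by simp
  also have "\<dots> = (\<Sum>y\<in>children adj r x. 1/2)" by simp
  also have "\<dots> < (\<Sum>y\<in>children adj r x. q x y)"
    using card by (intro sum_strict_mono * finite_children) auto
  also have "\<dots> = 1" using transition by (simp add: transition_tree_def)
  finally show False by simp
qed

definition light_child :: "'v \<Rightarrow> 'v" where
  "light_child x = (SOME y. y \<in> children adj r x \<and> q x y \<le> 1/2)"

lemma light_child: "light_child x \<in> children adj r x" "q x (light_child x) \<le> 1/2"
proof -
  have "\<exists>y. y \<in> children adj r x \<and> q x y \<le> 1/2" using ex_light_child by blast
  from someI_ex[OF this] show "light_child x \<in> children adj r x" "q x (light_child x) \<le> 1/2"
    unfolding light_child_def by auto
qed

lemma parent_light_child [simp]: "parent (light_child x) = x"
  using light_child(1) by (rule parent_child)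

lemma countable_vertices: "countable (UNIV :: 'v set)"
proof -
  have "(UNIV :: 'v set) = (\<Union>n. level adj r n)" by (auto simp: level_def)
  moreover have "countable (\<Union>n. level adj r n)"
    by (intro countable_UN countable_finite finite_level countableI_type)
  ultimately show ?thesis by simp
qed

end

section \<open>The boundary measure\<close>

text \<open>The measure is taken before completion, where the cylinders generate the
  \<sigma>-algebra; results pass to \<open>completion Q\<close> afterwards.\<close>

locale boundary_prob = probability_tree adj r q + prob_space Q
  for adj :: "'v \<Rightarrow> 'v \<Rightarrow> bool" and r :: 'v and q :: "'v \<Rightarrow> 'v \<Rightarrow> real"
    and Q :: "'v set measure" +
  assumes space_Q: "space Q = boundary adj r"
    and sets_Q: "sets Q = sigma_sets (boundary adj r) (\<Union>n\<in>{1..}. level_algebra adj r n)"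
    and measure_Q: "\<And>n y. 1 \<le> n \<Longrightarrow> y 0 = r \<Longrightarrow> (\<And>j. j < n \<Longrightarrow> y (Suc j) \<in> children adj r (y j)) \<Longrightarrow>
      measure Q (cylinder adj r (y n)) = (\<Prod>j<n. q (y j) (y (Suc j)))"
begin

lemma cylinder_subset: "cylinder adj r x \<subseteq> boundary adj r"
  by (auto simp: cylinder_def)

lemma cylinder_root: "cylinder adj r r = boundary adj r"
  by (auto simp: cylinder_eq depth_eq_0_iff[symmetric])

lemma cylinder_sets [measurable, simp]: "cylinder adj r x \<in> sets Q"
proof (cases "depth x")
  \<comment> \<open>The generating algebras begin at level 1, so the cylinder of the root is
    obtained as the whole space instead.\<close>
  case 0
  then have "cylinder adj r x = space Q" by (simp add: depth_eq_0_iff cylinder_root space_Q)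
  then show ?thesis by simp
next
  case (Suc n)
  have "cylinder adj r x \<in> level_algebra adj r (Suc n)"
    unfolding level_algebra_def using Suc by (intro sigma_sets.Basic) (auto simp: level_def)
  then show ?thesis unfolding sets_Q by (intro sigma_sets.Basic) auto
qed

lemma sets_Q_subset: "sets Q \<subseteq> sigma_sets (boundary adj r) (range (cylinder adj r))"
  unfolding sets_Q level_algebra_def
  by (intro sigma_sets_mono UN_least sigma_sets_mono') auto

text \<open>Points have cylinders or the empty set as preimages, and any set of vertices is a
  countable union of points.\<close>

lemma vertex_at_measurable [measurable]: "vertex_at n \<in> Q \<rightarrow>\<^sub>M count_space UNIV"
proof (rule measurableI)
  fix C :: "'v set"
  have "vertex_at n -` {x} \<inter> space Q \<in> sets Q" for x
  proof (cases "depth x = n")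
    case True
    then have "vertex_at n -` {x} \<inter> space Q = cylinder adj r x"
      by (auto simp: cylinder_eq space_Q)
    then show ?thesis by simp
  next
    case False
    then have "vertex_at n -` {x} \<inter> space Q = {}"
      using depth_vertex_at by (auto simp: space_Q)
    then show ?thesis by (metis sets.empty_sets)
  qed
  then have "(\<Union>x\<in>C. vertex_at n -` {x} \<inter> space Q) \<in> sets Q"
    by (intro sets.countable_UN'' countable_subset[OF subset_UNIV countable_vertices])
  also have "(\<Union>x\<in>C. vertex_at n -` {x} \<inter> space Q) = vertex_at n -` C \<inter> space Q" by auto
  finally show "vertex_at n -` C \<inter> space Q \<in> sets Q" .
qed auto

lemma boundary_trace_measurable:
  "boundary_trace adj r n f \<in> borel_measurable Q"
  unfolding boundary_trace_eq by (rule measurable_compose[OF vertex_at_measurable]) simp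

text \<open>Cylinders of distinct vertices of one level are disjoint, being different fibres of
  \<open>vertex_at n\<close>.\<close>

lemma measure_vertex_at:
  assumes "finite X" "X \<subseteq> level adj r n"
  shows "prob {e \<in> space Q. vertex_at n e \<in> X} = (\<Sum>x\<in>X. prob (cylinder adj r x))"
proof -
  have "{e \<in> space Q. vertex_at n e \<in> X} = (\<Union>x\<in>X. cylinder adj r x)"
    using assms(2) by (auto simp: cylinder_eq space_Q level_def)
  moreover have "disjoint_family_on (cylinder adj r) X"
    unfolding disjoint_family_on_def
  proof (intro ballI impI)
    fix x y assume "x \<in> X" "y \<in> X" "x \<noteq> y"
    with assms(2) have "depth x = depth y" by (auto simp: level_def)
    with \<open>x \<noteq> y\<close> show "cylinder adj r x \<inter> cylinder adj r y = {}" by (auto simp: cylinder_eq)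
  qed
  ultimately show ?thesis
    using finite_measure_finite_Union[OF assms(1), of "cylinder adj r"] by (simp add: image_subset_iff)
qed

section \<open>Mass of the iterated light children\<close>

lemma ex_descent:
  "\<exists>y. y 0 = r \<and> (\<forall>j<depth x. y (Suc j) \<in> children adj r (y j)) \<and> y (depth x) = x"
proof (induction "depth x" arbitrary: x)
  case 0
  then show ?case by (intro exI[of _ "\<lambda>_. r"]) (simp add: depth_eq_0_iff)
next
  case (Suc n)
  from Suc(2) obtain z where z: "depth z = n" "x \<in> children adj r z"
    using ex_parent by metis
  with Suc(1)[of z] obtain y where "y 0 = r" "\<forall>j<n. y (Suc j) \<in> children adj r (y j)" "y n = z"
    by auto
  with z show ?case
    by (intro exI[of _ "y(Suc n := x)"]) (auto simp: less_Suc_eq)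
qed

lemma prob_light_child:
  "prob (cylinder adj r (light_child x)) \<le> prob (cylinder adj r x) / 2"
proof -
  obtain y where y: "y 0 = r" "\<And>j. j < depth x \<Longrightarrow> y (Suc j) \<in> children adj r (y j)" "y (depth x) = x"
    using ex_descent by blast
  define n where "n = depth x"
  let ?c = "light_child x"
  \<comment> \<open>Prolonging the descent to \<open>x\<close> by its light child adds the single
    factor \<open>q x ?c\<close>, which is at most 1/2.\<close>
  define z where "z = y(Suc n := ?c)"
  have z: "z 0 = r" "z (Suc n) = ?c" "\<And>j. j \<le> n \<Longrightarrow> z j = y j"
    using y by (auto simp: z_def n_def)
  have children: "z (Suc j) \<in> children adj r (z j)" if "j < Suc n" for j
    using that y light_child(1)[of x] by (auto simp: z_def n_def less_Suc_eq)
  have "prob (cylinder adj r x) = (\<Prod>j<n. q (y j) (y (Suc j)))"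
  proof (cases "n = 0")
    \<comment> \<open>The product formula is given from level 1 on. At the root both sides are 1:
      the mass of the whole space and the empty product.\<close>
    case True
    then have "x = r" by (simp add: n_def depth_eq_0_iff)
    with True show ?thesis by (simp add: cylinder_root space_Q[symmetric] prob_space)
  next
    case False
    with y show ?thesis using measure_Q[of n y] by (simp add: n_def)
  qed
  also have "\<dots> = (\<Prod>j<n. q (z j) (z (Suc j)))"
    by (intro prod.cong) (auto simp: z(3))
  finally have x: "prob (cylinder adj r x) = (\<Prod>j<n. q (z j) (z (Suc j)))" .
  have "prob (cylinder adj r ?c) = (\<Prod>j<Suc n. q (z j) (z (Suc j)))"
    using measure_Q[of "Suc n" z] z children by simp
  also have "\<dots> = prob (cylinder adj r x) * q x ?c"
    using z y(3) by (simp add: x n_def)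
  also have "\<dots> \<le> prob (cylinder adj r x) * (1/2)"
    by (intro mult_left_mono light_child(2)) simp
  finally show ?thesis by simp
qed

text \<open>The mass is at most 1 on level \<open>n\<close>. Since \<open>light_child\<close> is
  injective, with \<open>parent\<close> as a left inverse, every iteration leaves at most half of
  it.\<close>

lemma prob_light_descendants:
  "prob {e \<in> space Q. vertex_at (n + k) e \<in> (light_child ^^ k) ` level adj r n} \<le> (1/2) ^ k"
proof -
  define W where "W k = (light_child ^^ k) ` level adj r n" for k
  have W_Suc: "W (Suc k) = light_child ` W k" for k by (auto simp: W_def)
  have fin: "finite (W k)" for k by (simp add: W_def finite_level)
  have lev: "W k \<subseteq> level adj r (n + k)" for k
  proof (induction k)
    case (Suc k)
    then show ?case
      using depth_child[OF light_child(1)] by (auto simp: W_Suc level_def)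
  qed (simp add: W_def)
  have inj: "inj_on light_child (W k)" for k
    by (metis inj_onI parent_light_child)
  have "(\<Sum>x\<in>W k. prob (cylinder adj r x)) \<le> (1/2) ^ k"
  proof (induction k)
    case 0
    show ?case using measure_vertex_at[OF fin lev, of 0] by (metis prob_le_1 power_0)
  next
    case (Suc k)
    have "(\<Sum>x\<in>W (Suc k). prob (cylinder adj r x)) = (\<Sum>x\<in>W k. prob (cylinder adj r (light_child x)))"
      unfolding W_Suc by (simp add: sum.reindex[OF inj])
    also have "\<dots> \<le> (\<Sum>x\<in>W k. prob (cylinder adj r x) / 2)"
      by (intro sum_mono prob_light_child)
    also have "\<dots> \<le> (1/2) ^ k / 2" using Suc by (simp flip: sum_divide_distrib)
    finally show ?case by simp
  qed
  then show ?thesis using measure_vertex_at[OF fin lev, of k] by (simp add: W_def)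
qed

section \<open>Approximation by functions of the vertex at one level\<close>

text \<open>Induction over the generated \<sigma>-algebra. Asking for all large \<open>m\<close>,
  not just one, lets finitely many approximations be taken at a common level in the union
  case.\<close>

lemma approximate_set:
  assumes "A \<in> sets Q" "0 < \<epsilon>"
  shows "\<forall>\<^sub>F m in sequentially. \<exists>C. prob (sym_diff A (vertex_at m -` C \<inter> space Q)) < \<epsilon>"
proof -
  have sets [measurable]: "vertex_at m -` C \<inter> space Q \<in> sets Q" for m C
    by (rule measurable_sets[OF vertex_at_measurable]) simp
  have "A \<in> sigma_sets (boundary adj r) (range (cylinder adj r))"
    using assms(1) sets_Q_subset by blast
  then show ?thesis using \<open>0 < \<epsilon>\<close>
  proof (induction arbitrary: \<epsilon>)
    case (Basic A)
    then obtain x where A: "A = cylinder adj r x" by blast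
    have "\<exists>C. prob (sym_diff A (vertex_at m -` C \<inter> space Q)) < \<epsilon>" if "depth x \<le> m" for m
    \<comment> \<open>From level \<open>depth x\<close> on, the ancestor of the current vertex
      decides membership in the cylinder, so the error is zero.\<close>
    proof (intro exI[of _ "{y. ancestor (depth x) y = x}"])
      have "A = vertex_at m -` {y. ancestor (depth x) y = x} \<inter> space Q"
        using that unfolding A cylinder_eq by (auto simp: space_Q ancestor_vertex_at)
      then have *: "sym_diff A (vertex_at m -` {y. ancestor (depth x) y = x} \<inter> space Q) = {}"
        by blast
      show "prob (sym_diff A (vertex_at m -` {y. ancestor (depth x) y = x} \<inter> space Q)) < \<epsilon>"
        unfolding * using Basic by simp
    qed
    then show ?case by (rule eventually_sequentiallyI)
  next
    case Empty
    then have "\<exists>C. prob (sym_diff {} (vertex_at m -` C \<inter> space Q)) < \<epsilon>" for m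
      by (intro exI[of _ "{}"]) simp
    then show ?case by simp
  next
    case (Compl A)
    have *: "sym_diff (boundary adj r - A) (vertex_at m -` (- C) \<inter> space Q)
      = sym_diff A (vertex_at m -` C \<inter> space Q)" for m C
    proof -
      have "A \<subseteq> boundary adj r"
        using Compl(1) by (rule sigma_sets_into_sp[rotated]) (use cylinder_subset in auto)
      then show ?thesis by (auto simp: space_Q)
    qed
    show ?case
      by (rule eventually_mono[OF Compl.IH[OF Compl.prems]]) (metis *)
  next
    case (Union A)
    have meas [measurable]: "A i \<in> sets Q" for i
    proof -
      have "sigma_sets (space Q) (range (cylinder adj r)) \<subseteq> sets Q"
        by (rule sets.sigma_sets_subset) auto
      with Union(1)[of i] show ?thesis by (auto simp: space_Q)
    qed
    \<comment> \<open>A finite partial union loses less than \<open>\<epsilon>/2\<close>, and its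
      members share the other half. The \<open>Suc\<close> in
      \<open>\<epsilon> / (2 * Suc n)\<close> keeps the bound positive for
      \<open>n = 0\<close>.\<close>
    have "(\<lambda>n. prob (\<Union>i<n. A i)) \<longlonglongrightarrow> prob (\<Union>n. \<Union>i<n. A i)"
      by (intro finite_Lim_measure_incseq) (auto simp: incseq_def intro: less_le_trans)
    moreover have "(\<Union>n. \<Union>i<n. A i) = (\<Union>i. A i)" by auto
    ultimately have "\<forall>\<^sub>F n in sequentially. prob (\<Union>i. A i) - \<epsilon>/2 < prob (\<Union>i<n. A i)"
      using \<open>0 < \<epsilon>\<close> by (intro order_tendstoD(1)) auto
    from eventually_happens'[OF sequentially_bot this] obtain n where n: "prob (\<Union>i. A i) - \<epsilon>/2 < prob (\<Union>i<n. A i)"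
      by blast
    have "prob ((\<Union>i. A i) - (\<Union>i<n. A i)) = prob (\<Union>i. A i) - prob (\<Union>i<n. A i)"
      by (intro finite_measure_Diff) auto
    with n have tail: "prob ((\<Union>i. A i) - (\<Union>i<n. A i)) < \<epsilon>/2" by simp
    have "\<forall>\<^sub>F m in sequentially. \<forall>i\<in>{..<n}. \<exists>C.
        prob (sym_diff (A i) (vertex_at m -` C \<inter> space Q)) < \<epsilon> / (2 * Suc n)"
      using Union.IH Union.prems
      by (intro eventually_ball_finite ballI) auto
    then show ?case
    proof (rule eventually_mono)
      fix m
      assume "\<forall>i\<in>{..<n}. \<exists>C. prob (sym_diff (A i) (vertex_at m -` C \<inter> space Q)) < \<epsilon> / (2 * Suc n)"
      then obtain C where
        C: "\<And>i. i < n \<Longrightarrow> prob (sym_diff (A i) (vertex_at m -` C i \<inter> space Q)) < \<epsilon> / (2 * Suc n)"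
        by (metis lessThan_iff)
      let ?D = "\<lambda>i. sym_diff (A i) (vertex_at m -` C i \<inter> space Q)"
      let ?T = "(\<Union>i. A i) - (\<Union>i<n. A i)"
      have "prob (\<Union>i<n. ?D i) \<le> (\<Sum>i<n. prob (?D i))"
        by (intro finite_measure_subadditive_finite) auto
      also have "\<dots> \<le> (\<Sum>i<n. \<epsilon> / (2 * Suc n))"
        using C by (intro sum_mono) (force intro: less_imp_le)
      also have "\<dots> = real n / real (Suc n) * (\<epsilon> / 2)" by simp
      also have "\<dots> \<le> 1 * (\<epsilon> / 2)" using \<open>0 < \<epsilon>\<close> by (intro mult_right_mono) auto
      finally have "prob (\<Union>i<n. ?D i) \<le> \<epsilon> / 2" by simp
      have sub: "sym_diff (\<Union>i. A i) (vertex_at m -` (\<Union>i<n. C i) \<inter> space Q)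
          \<subseteq> ?T \<union> (\<Union>i<n. ?D i)"
        by blast
      have "prob (sym_diff (\<Union>i. A i) (vertex_at m -` (\<Union>i<n. C i) \<inter> space Q))
          \<le> prob (?T \<union> (\<Union>i<n. ?D i))"
        by (rule finite_measure_mono[OF sub]) measurable
      also have "\<dots> \<le> prob ?T + prob (\<Union>i<n. ?D i)"
        by (intro measure_Un_le) auto
      also have "\<dots> < \<epsilon>" using tail \<open>prob (\<Union>i<n. ?D i) \<le> \<epsilon> / 2\<close> by simp
      finally show "\<exists>C. prob (sym_diff (\<Union>i. A i) (vertex_at m -` C \<inter> space Q)) < \<epsilon>" by blast
    qed
  qed
qed

text \<open>A set of the completion differs from a set of \<open>Q\<close> by a part of a null set,
  so an approximation of the latter serves it as well.\<close>

lemma approximate_completion_set: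
  assumes "A \<in> sets (completion Q)" "0 < \<epsilon>"
  shows "\<forall>\<^sub>F m in sequentially. \<exists>C.
    measure (completion Q) (sym_diff A (vertex_at m -` C \<inter> space Q)) < \<epsilon>"
proof -
  interpret P: prob_space "completion Q" by (rule prob_space_completion)
  have sets [measurable]: "vertex_at m -` C \<inter> space Q \<in> sets Q" for m C
    by (rule measurable_sets[OF vertex_at_measurable]) simp
  from assms(1) obtain S N N' where *: "A = S \<union> N" "N \<subseteq> N'" "N' \<in> null_sets Q" "S \<in> sets Q"
    by (rule sets_completionE)
  note [measurable] = *(4)
  have [measurable]: "N' \<in> sets Q" using *(3) by auto
  have le: "measure (completion Q) (sym_diff A (vertex_at m -` C \<inter> space Q))
      \<le> prob (sym_diff S (vertex_at m -` C \<inter> space Q))" for m C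
  proof -
    let ?B = "sym_diff S (vertex_at m -` C \<inter> space Q)"
    have "sym_diff A (vertex_at m -` C \<inter> space Q) \<subseteq> ?B \<union> N'"
      using *(1,2) by blast
    moreover have "?B \<union> N' \<in> sets (completion Q)"
      by (intro sets_completionI_sets) measurable
    ultimately have "measure (completion Q) (sym_diff A (vertex_at m -` C \<inter> space Q))
        \<le> measure (completion Q) (?B \<union> N')"
      by (rule P.finite_measure_mono)
    also have "\<dots> = prob (?B \<union> N')" by (intro measure_completion) measurable
    also have "\<dots> \<le> prob ?B + prob N'" by (intro measure_Un_le) measurable
    also have "prob N' = 0" using *(3) by (simp add: null_setsD1 measure_def)
    finally show ?thesis by simp
  qed
  show ?thesis
    by (rule eventually_mono[OF approximate_set[OF *(4) assms(2)]]) (meson le le_less_trans)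
qed

text \<open>Large values of \<open>s\<close> have small probability, and the finitely many remaining
  fibres are approximated at one common level.\<close>

lemma approximate_nat_valued:
  fixes s :: "'v set \<Rightarrow> nat"
  assumes [measurable]: "s \<in> completion Q \<rightarrow>\<^sub>M count_space UNIV" and "0 < \<epsilon>"
  shows "\<exists>p c. measure (completion Q) {e \<in> space Q. s e \<noteq> c (vertex_at p e)} < \<epsilon>"
proof -
  interpret P: prob_space "completion Q" by (rule prob_space_completion)
  have vm [measurable]: "vertex_at n \<in> completion Q \<rightarrow>\<^sub>M count_space UNIV" for n
    by (intro measurable_completion vertex_at_measurable)
  let ?A = "\<lambda>i. s -` {i} \<inter> space Q"
  have A: "s -` X \<inter> space Q \<in> sets (completion Q)" for X
    using measurable_sets[OF assms(1), of X] by simp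
  have V: "vertex_at m -` X \<inter> space Q \<in> sets (completion Q)" for m X
    using measurable_sets[OF vm, of X m] by simp
  have "(\<lambda>n. P.prob (s -` {n..} \<inter> space Q)) \<longlonglongrightarrow> P.prob (\<Inter>n. s -` {n..} \<inter> space Q)"
    using A by (intro P.finite_Lim_measure_decseq) (auto simp: decseq_def)
  also have "(\<Inter>n. s -` {n..} \<inter> space Q) = {}"
  proof -
    have "e \<notin> s -` {Suc (s e)..}" for e by simp
    then show ?thesis by blast
  qed
  finally have "\<forall>\<^sub>F n in sequentially. P.prob (s -` {n..} \<inter> space Q) < \<epsilon>/2"
    using \<open>0 < \<epsilon>\<close> by (intro order_tendstoD(2)) auto
  from eventually_happens'[OF sequentially_bot this] obtain n where n: "P.prob (s -` {n..} \<inter> space Q) < \<epsilon>/2"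
    by blast
  have "\<forall>\<^sub>F m in sequentially. \<forall>i\<in>{..<n}. \<exists>C.
      P.prob (sym_diff (?A i) (vertex_at m -` C \<inter> space Q)) < \<epsilon> / (2 * Suc n)"
    using \<open>0 < \<epsilon>\<close> A
    by (intro eventually_ball_finite ballI approximate_completion_set) auto
  from eventually_happens'[OF sequentially_bot this] obtain m where "\<forall>i\<in>{..<n}. \<exists>C.
      P.prob (sym_diff (?A i) (vertex_at m -` C \<inter> space Q)) < \<epsilon> / (2 * Suc n)"
    by blast
  then obtain C where
    C: "\<And>i. i < n \<Longrightarrow> P.prob (sym_diff (?A i) (vertex_at m -` C i \<inter> space Q)) < \<epsilon> / (2 * Suc n)"
    by (metis lessThan_iff)
  let ?D = "\<lambda>i. sym_diff (?A i) (vertex_at m -` C i \<inter> space Q)"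
  \<comment> \<open>This is the first \<open>i < n\<close> with \<open>x \<in> C i\<close>. If there
    is none, the implication first holds, vacuously, at \<open>n\<close>, which is then the
    value.\<close>
  define c where "c x = (LEAST i. i < n \<longrightarrow> x \<in> C i)" for x
  have D: "?D i \<in> sets (completion Q)" for i
    by (intro sets.Un sets.Diff A V)
  \<comment> \<open>Off the sets \<open>?D i\<close> the condition
    \<open>vertex_at m e \<in> C i\<close> means \<open>s e = i\<close>, so \<open>c\<close>
    recovers \<open>s e\<close> whenever that is below \<open>n\<close>.\<close>
  have sub: "{e \<in> space Q. s e \<noteq> c (vertex_at m e)} \<subseteq> (s -` {n..} \<inter> space Q) \<union> (\<Union>i<n. ?D i)"
  proof (rule subsetI, rule ccontr)
    fix e
    assume e: "e \<in> {e \<in> space Q. s e \<noteq> c (vertex_at m e)}"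
      and out: "e \<notin> (s -` {n..} \<inter> space Q) \<union> (\<Union>i<n. ?D i)"
    have "s e < n" using e out by simp
    have iff: "vertex_at m e \<in> C i \<longleftrightarrow> s e = i" if "i < n" for i
    proof -
      have "e \<notin> ?D i" using out that by blast
      then show ?thesis using e by auto
    qed
    have "c (vertex_at m e) = s e"
      unfolding c_def
    proof (rule Least_equality)
      show "s e < n \<longrightarrow> vertex_at m e \<in> C (s e)" using iff by simp
    next
      fix i
      assume "i < n \<longrightarrow> vertex_at m e \<in> C i"
      then show "s e \<le> i" using iff[of i] \<open>s e < n\<close> by (cases "i < n") simp_all
    qed
    with e show False by simp
  qed
  have "P.prob (\<Union>i<n. ?D i) \<le> (\<Sum>i<n. P.prob (?D i))"
    using D by (intro P.finite_measure_subadditive_finite) auto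
  also have "\<dots> \<le> (\<Sum>i<n. \<epsilon> / (2 * Suc n))"
    using C by (intro sum_mono) (force intro: less_imp_le)
  also have "\<dots> = real n / real (Suc n) * (\<epsilon> / 2)" by simp
  also have "\<dots> \<le> 1 * (\<epsilon> / 2)" using \<open>0 < \<epsilon>\<close> by (intro mult_right_mono) auto
  finally have le: "P.prob (\<Union>i<n. ?D i) \<le> \<epsilon> / 2" by simp
  have UD: "(\<Union>i<n. ?D i) \<in> sets (completion Q)" using D by blast
  have "P.prob {e \<in> space Q. s e \<noteq> c (vertex_at m e)}
      \<le> P.prob ((s -` {n..} \<inter> space Q) \<union> (\<Union>i<n. ?D i))"
    by (intro P.finite_measure_mono[OF sub] sets.Un A UD)
  also have "\<dots> \<le> P.prob (s -` {n..} \<inter> space Q) + P.prob (\<Union>i<n. ?D i)"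
    by (intro measure_Un_le A UD)
  also have "\<dots> < \<epsilon>" using n le by simp
  finally show ?thesis by blast
qed

end

section \<open>Convergence in probability for separable values\<close>

lemma closure_UNIV_approach:
  fixes D :: "'e::metric_space set"
  assumes "closure D = UNIV" "0 < \<epsilon>"
  obtains d where "d \<in> D" "dist x d < \<epsilon>"
proof -
  have "x \<in> closure D" using assms(1) by simp
  then obtain d where "d \<in> D" "dist d x < \<epsilon>"
    unfolding closure_approachable using assms(2) by blast
  with that show thesis by (simp add: dist_commute)
qed

lemma div_one_plus_le:
  fixes t :: real
  assumes "0 \<le> t"
  shows "t / (1 + t) \<le> t" "t / (1 + t) \<le> 1"
  using assms by (simp_all add: divide_le_eq mult_le_cancel_left1)

text \<open>Separability enters as a countable dense set \<open>D\<close>, from which the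
  measurability of distances and the discretization are both derived.\<close>

locale separable_L0 = prob_space P
  for P :: "'a measure" +
  fixes D :: "'e::metric_space set"
  assumes countable_D: "countable D" and closure_D: "closure D = UNIV"
begin

section \<open>Measurability and integrability of distances\<close>

lemma dist_const_measurable:
  assumes "\<psi> \<in> borel_measurable P"
  shows "(\<lambda>x. dist (\<psi> x) (d :: 'e)) \<in> borel_measurable P"
proof (rule measurable_compose[OF assms])
  have "continuous_on UNIV (\<lambda>y::'e. dist y d)" by (intro continuous_intros)
  then show "(\<lambda>y. dist y d) \<in> borel_measurable borel" by (rule borel_measurable_continuous_onI)
qed

text \<open>The condition \<open>dist (\<psi> x) (\<phi> x) < a\<close> splits into countably many
  pairs of separate conditions on the two functions, through a point \<open>d\<close> of
  \<open>D\<close> and a rational \<open>s\<close>.\<close>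

lemma dist_measurable:
  fixes \<psi> \<phi> :: "'a \<Rightarrow> 'e"
  assumes "\<psi> \<in> borel_measurable P" "\<phi> \<in> borel_measurable P"
  shows "(\<lambda>x. dist (\<psi> x) (\<phi> x)) \<in> borel_measurable P"
proof (unfold borel_measurable_iff_less, intro allI)
  fix a :: real
  let ?S = "\<lambda>d s. {x \<in> space P. dist (\<psi> x) d < s \<and> dist (\<phi> x) d < a - s}"
  have "{x \<in> space P. dist (\<psi> x) (\<phi> x) < a} = (\<Union>d\<in>D. \<Union>s\<in>\<rat>. ?S d s)"
  proof (intro equalityI subsetI)
    fix x assume x: "x \<in> {x \<in> space P. dist (\<psi> x) (\<phi> x) < a}"
    \<comment> \<open>The slack \<open>g\<close> is cut in thirds: a point within \<open>g/3\<close>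
      of \<open>\<psi> x\<close> has distance less than \<open>a - 2*g/3\<close> from
      \<open>\<phi> x\<close>, which leaves room for \<open>s\<close> between \<open>g/3\<close> and
      \<open>2*g/3\<close>.\<close>
    define g where "g = a - dist (\<psi> x) (\<phi> x)"
    have "0 < g / 3" using x by (simp add: g_def)
    then obtain d where d: "d \<in> D" "dist (\<psi> x) d < g/3"
      using closure_UNIV_approach[OF closure_D] by blast
    from \<open>0 < g / 3\<close> obtain s where s: "s \<in> \<rat>" "g/3 < s" "s < 2*g/3"
      using Rats_dense_in_real[of "g/3" "2*g/3"] by auto
    have "dist (\<phi> x) d \<le> dist (\<psi> x) (\<phi> x) + dist (\<psi> x) d"
      by (rule dist_triangle3)
    with d s have "dist (\<psi> x) d < s" "dist (\<phi> x) d < a - s"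
      by (simp_all add: g_def field_simps)
    with x d s show "x \<in> (\<Union>d\<in>D. \<Union>s\<in>\<rat>. ?S d s)" by blast
  next
    fix x assume "x \<in> (\<Union>d\<in>D. \<Union>s\<in>\<rat>. ?S d s)"
    then obtain d s where "x \<in> space P" "dist (\<psi> x) d < s" "dist (\<phi> x) d < a - s" by blast
    moreover have "dist (\<psi> x) (\<phi> x) \<le> dist (\<psi> x) d + dist (\<phi> x) d"
      by (rule dist_triangle2)
    ultimately show "x \<in> {x \<in> space P. dist (\<psi> x) (\<phi> x) < a}" by simp
  qed
  also have "\<dots> \<in> sets P"
  proof (intro sets.countable_UN'' countable_D countable_rat)
    fix d :: 'e and s :: real
    note [measurable] = dist_const_measurable[OF assms(1)] dist_const_measurable[OF assms(2)]
    show "?S d s \<in> sets P" by measurable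
  qed
  finally show "{x \<in> space P. dist (\<psi> x) (\<phi> x) < a} \<in> sets P" .
qed

lemma L0_integrand_measurable:
  fixes \<psi> \<phi> :: "'a \<Rightarrow> 'e"
  assumes "\<psi> \<in> borel_measurable P" "\<phi> \<in> borel_measurable P"
  shows "(\<lambda>x. dist (\<psi> x) (\<phi> x) / (1 + dist (\<psi> x) (\<phi> x))) \<in> borel_measurable P"
  using dist_measurable[OF assms] by measurable

lemma L0_integrable:
  fixes \<psi> \<phi> :: "'a \<Rightarrow> 'e"
  assumes "\<psi> \<in> borel_measurable P" "\<phi> \<in> borel_measurable P"
  shows "integrable P (\<lambda>x. dist (\<psi> x) (\<phi> x) / (1 + dist (\<psi> x) (\<phi> x)))"
proof (rule integrable_const_bound[where B = 1])
  have "norm (dist (\<psi> x) (\<phi> x) / (1 + dist (\<psi> x) (\<phi> x))) \<le> 1" for x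
    using div_one_plus_le(2)[OF zero_le_dist, of "\<psi> x" "\<phi> x"] by simp
  then show "AE x in P. norm (dist (\<psi> x) (\<phi> x) / (1 + dist (\<psi> x) (\<phi> x))) \<le> 1" by simp
qed (rule L0_integrand_measurable[OF assms])

section \<open>The metric on classes of functions\<close>

lemma some_L0_class:
  fixes \<psi> :: "'a \<Rightarrow> 'e"
  assumes "\<psi> \<in> borel_measurable P"
  shows "(SOME \<phi>. \<phi> \<in> L0_class P \<psi>) \<in> borel_measurable P"
    "AE x in P. \<psi> x = (SOME \<phi>. \<phi> \<in> L0_class P \<psi>) x"
proof -
  have "\<psi> \<in> L0_class P \<psi>" using assms by (simp add: L0_class_def)
  then have "(SOME \<phi>. \<phi> \<in> L0_class P \<psi>) \<in> L0_class P \<psi>" by (rule someI[of "\<lambda>\<phi>. \<phi> \<in> L0_class P \<psi>"])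
  then show "(SOME \<phi>. \<phi> \<in> L0_class P \<psi>) \<in> borel_measurable P"
    "AE x in P. \<psi> x = (SOME \<phi>. \<phi> \<in> L0_class P \<psi>) x"
    by (simp_all add: L0_class_def)
qed

text \<open>The representatives picked by \<open>SOME\<close> agree almost everywhere with the given
  ones.\<close>

lemma L0_dist_class:
  fixes \<psi> \<phi> :: "'a \<Rightarrow> 'e"
  assumes "\<psi> \<in> borel_measurable P" "\<phi> \<in> borel_measurable P"
  shows "L0_dist P (L0_class P \<psi>) (L0_class P \<phi>) =
    (\<integral>x. dist (\<psi> x) (\<phi> x) / (1 + dist (\<psi> x) (\<phi> x)) \<partial>P)"
  unfolding L0_dist_def Let_def
proof (rule integral_cong_AE)
  show "AE x in P. dist ((SOME \<phi>. \<phi> \<in> L0_class P \<psi>) x) ((SOME \<psi>. \<psi> \<in> L0_class P \<phi>) x) /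
      (1 + dist ((SOME \<phi>. \<phi> \<in> L0_class P \<psi>) x) ((SOME \<psi>. \<psi> \<in> L0_class P \<phi>) x)) =
      dist (\<psi> x) (\<phi> x) / (1 + dist (\<psi> x) (\<phi> x))"
    using some_L0_class(2)[OF assms(1)] some_L0_class(2)[OF assms(2)] by eventually_elim simp
qed (intro L0_integrand_measurable some_L0_class assms)+

lemma L0_class_eq_iff:
  fixes \<psi> \<phi> :: "'a \<Rightarrow> 'e"
  assumes "\<psi> \<in> borel_measurable P" "\<phi> \<in> borel_measurable P"
  shows "L0_class P \<psi> = L0_class P \<phi> \<longleftrightarrow> (AE x in P. \<psi> x = \<phi> x)"
proof
  assume "L0_class P \<psi> = L0_class P \<phi>"
  moreover have "\<phi> \<in> L0_class P \<phi>" using assms by (simp add: L0_class_def)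
  ultimately have "\<phi> \<in> L0_class P \<psi>" by simp
  then show "AE x in P. \<psi> x = \<phi> x" by (simp add: L0_class_def)
next
  assume *: "AE x in P. \<psi> x = \<phi> x"
  have "(AE x in P. \<psi> x = \<theta> x) \<longleftrightarrow> (AE x in P. \<phi> x = \<theta> x)" for \<theta>
  proof
    assume "AE x in P. \<psi> x = \<theta> x"
    with * show "AE x in P. \<phi> x = \<theta> x" by eventually_elim simp
  next
    assume "AE x in P. \<phi> x = \<theta> x"
    with * show "AE x in P. \<psi> x = \<theta> x" by eventually_elim simp
  qed
  then show "L0_class P \<psi> = L0_class P \<phi>" by (simp add: L0_class_def)
qed

lemma Metric_space_L0: "Metric_space (L0 P :: ('a \<Rightarrow> 'e) set set) (L0_dist P)"
proof
  fix A B :: "('a \<Rightarrow> 'e) set"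
  show "0 \<le> L0_dist P A B" by (simp add: L0_dist_def Let_def integral_nonneg)
  show "L0_dist P A B = L0_dist P B A" by (simp add: L0_dist_def Let_def dist_commute)
next
  fix A B :: "('a \<Rightarrow> 'e) set"
  assume "A \<in> L0 P" "B \<in> L0 P"
  then obtain \<psi> \<phi> where AB: "A = L0_class P \<psi>" "B = L0_class P \<phi>"
    and meas: "\<psi> \<in> borel_measurable P" "\<phi> \<in> borel_measurable P"
    by (auto simp: L0_def)
  have "L0_dist P A B = 0 \<longleftrightarrow> (AE x in P. dist (\<psi> x) (\<phi> x) / (1 + dist (\<psi> x) (\<phi> x)) = 0)"
    unfolding AB L0_dist_class[OF meas]
    by (intro integral_nonneg_eq_0_iff_AE L0_integrable meas) simp
  also have "\<dots> \<longleftrightarrow> (AE x in P. \<psi> x = \<phi> x)"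
  proof -
    have "dist (\<psi> x) (\<phi> x) / (1 + dist (\<psi> x) (\<phi> x)) = 0 \<longleftrightarrow> \<psi> x = \<phi> x" for x
      using zero_le_dist[of "\<psi> x" "\<phi> x"] by (auto simp: add_nonneg_eq_0_iff)
    then show ?thesis by simp
  qed
  finally show "L0_dist P A B = 0 \<longleftrightarrow> A = B" by (simp add: AB L0_class_eq_iff[OF meas])
next
  fix A B C :: "('a \<Rightarrow> 'e) set"
  assume "A \<in> L0 P" "B \<in> L0 P" "C \<in> L0 P"
  then obtain \<psi> \<phi> \<theta> where eq: "A = L0_class P \<psi>" "B = L0_class P \<phi>" "C = L0_class P \<theta>"
    and m: "\<psi> \<in> borel_measurable P" "\<phi> \<in> borel_measurable P" "\<theta> \<in> borel_measurable P"
    by (auto simp: L0_def)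
  \<comment> \<open>The triangle inequality passes from \<open>dist\<close> to the integrand because
    \<open>t / (1 + t)\<close> is increasing and subadditive for \<open>t \<ge> 0\<close>.\<close>
  have real: "c / (1 + c) \<le> a / (1 + a) + b / (1 + b)"
    if "0 \<le> a" "0 \<le> b" "0 \<le> c" "c \<le> a + b" for a b c :: real
  proof -
    have "c / (1 + c) \<le> (a + b) / (1 + (a + b))"
      using that by (simp add: divide_simps) (simp add: algebra_simps)
    also have "\<dots> = a / (1 + (a + b)) + b / (1 + (a + b))" by (simp add: add_divide_distrib)
    also have "\<dots> \<le> a / (1 + a) + b / (1 + b)"
      using that by (intro add_mono divide_left_mono) auto
    finally show ?thesis .
  qed
  have "L0_dist P A C \<le> (\<integral>x. dist (\<psi> x) (\<phi> x) / (1 + dist (\<psi> x) (\<phi> x)) +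
      dist (\<phi> x) (\<theta> x) / (1 + dist (\<phi> x) (\<theta> x)) \<partial>P)"
    unfolding eq L0_dist_class[OF m(1,3)]
    by (intro integral_mono Bochner_Integration.integrable_add L0_integrable m real zero_le_dist
        dist_triangle)
  also have "\<dots> = L0_dist P A B + L0_dist P B C"
    unfolding eq L0_dist_class[OF m(1,2)] L0_dist_class[OF m(2,3)]
    by (intro Bochner_Integration.integral_add L0_integrable m)
  finally show "L0_dist P A C \<le> L0_dist P A B + L0_dist P B C" .
qed

text \<open>Where the distance is below \<delta>, so is the integrand; elsewhere the integrand is at
  most 1.\<close>

lemma L0_dist_le:
  fixes \<psi> \<phi> :: "'a \<Rightarrow> 'e"
  assumes m: "\<psi> \<in> borel_measurable P" "\<phi> \<in> borel_measurable P"
    and "0 \<le> \<delta>"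
  shows "L0_dist P (L0_class P \<psi>) (L0_class P \<phi>)
    \<le> \<delta> + prob {x \<in> space P. \<delta> \<le> dist (\<psi> x) (\<phi> x)}"
proof -
  note [measurable] = dist_measurable[OF m]
  define B where "B = {x \<in> space P. \<delta> \<le> dist (\<psi> x) (\<phi> x)}"
  have [measurable]: "B \<in> sets P" unfolding B_def by measurable
  have "(\<integral>x. dist (\<psi> x) (\<phi> x) / (1 + dist (\<psi> x) (\<phi> x)) \<partial>P) \<le> (\<integral>x. \<delta> + indicator B x \<partial>P)"
  proof (intro integral_mono L0_integrable m)
    show "integrable P (\<lambda>x. \<delta> + indicator B x :: real)"
      by (intro Bochner_Integration.integrable_add integrable_const integrable_real_indicator)
        (simp_all add: emeasure_eq_measure)
    fix x assume x: "x \<in> space P"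
    let ?t = "dist (\<psi> x) (\<phi> x)"
    show "?t / (1 + ?t) \<le> \<delta> + indicator B x"
    proof (cases "x \<in> B")
      case True
      with \<open>0 \<le> \<delta>\<close> div_one_plus_le(2)[OF zero_le_dist, of "\<psi> x" "\<phi> x"] show ?thesis by simp
    next
      case False
      with x div_one_plus_le(1)[OF zero_le_dist, of "\<psi> x" "\<phi> x"] show ?thesis
        by (simp add: B_def)
    qed
  qed
  also have "\<dots> = \<delta> + prob B"
    by (subst Bochner_Integration.integral_add)
      (auto simp: prob_space emeasure_eq_measure intro!: integrable_real_indicator)
  finally show ?thesis by (simp add: L0_dist_class[OF m] B_def)
qed

text \<open>Universality is proved from this form of openness alone. Half the radius of a ball in
  \<open>V\<close> serves both as the tolerance and as the allowed probability.\<close>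

lemma openin_L0_topology_in_probability:
  assumes "openin (L0_topology P) (V :: ('a \<Rightarrow> 'e) set set)" "V \<noteq> {}"
  obtains \<psi> \<delta> where "\<psi> \<in> borel_measurable P" "0 < \<delta>"
    "\<And>\<phi>. \<phi> \<in> borel_measurable P \<Longrightarrow> prob {x \<in> space P. \<delta> \<le> dist (\<psi> x) (\<phi> x)} < \<delta> \<Longrightarrow>
      L0_class P \<phi> \<in> V"
proof -
  interpret L: Metric_space "L0 P :: ('a \<Rightarrow> 'e) set set" "L0_dist P" by (rule Metric_space_L0)
  from assms obtain A \<epsilon> where A: "A \<in> L0 P" "0 < \<epsilon>" "L.mball A \<epsilon> \<subseteq> V"
    unfolding L0_topology_def L.openin_mtopology by blast
  then obtain \<psi> where \<psi>: "\<psi> \<in> borel_measurable P" "A = L0_class P \<psi>" by (auto simp: L0_def)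
  show thesis
  proof (rule that[OF \<psi>(1), of "\<epsilon>/2"])
    fix \<phi> :: "'a \<Rightarrow> 'e"
    assume \<phi>: "\<phi> \<in> borel_measurable P" "prob {x \<in> space P. \<epsilon>/2 \<le> dist (\<psi> x) (\<phi> x)} < \<epsilon>/2"
    then have "L0_dist P A (L0_class P \<phi>) < \<epsilon>"
      using L0_dist_le[OF \<psi>(1) \<phi>(1), of "\<epsilon>/2"] A(2) \<psi>(2) by simp
    moreover have "L0_class P \<phi> \<in> L0 P" using \<phi>(1) by (simp add: L0_def)
    ultimately have "L0_class P \<phi> \<in> L.mball A \<epsilon>" using A(1) by (simp add: L.in_mball)
    with A(3) show "L0_class P \<phi> \<in> V" by blast
  qed (use A in simp)
qed

text \<open>Taking the least suitable index in an enumeration of \<open>D\<close> makes the choice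
  of a nearby point measurable.\<close>

lemma discretize:
  fixes \<psi> :: "'a \<Rightarrow> 'e"
  assumes "\<psi> \<in> borel_measurable P" "0 < \<delta>"
  obtains s where "s \<in> P \<rightarrow>\<^sub>M count_space UNIV"
    "\<And>x. dist (\<psi> x) (from_nat_into D (s x)) < \<delta>"
proof
  note [measurable] = dist_const_measurable[OF assms(1)]
  show "(\<lambda>x. LEAST i. dist (\<psi> x) (from_nat_into D i) < \<delta>) \<in> P \<rightarrow>\<^sub>M count_space UNIV"
    by measurable
  fix x
  obtain d where "d \<in> D" "dist (\<psi> x) d < \<delta>"
    using closure_UNIV_approach[OF closure_D assms(2)] by blast
  then have "\<exists>i. dist (\<psi> x) (from_nat_into D i) < \<delta>"
    using from_nat_into_surj[OF countable_D] by blast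
  then show "dist (\<psi> x) (from_nat_into D (LEAST i. dist (\<psi> x) (from_nat_into D i) < \<delta>)) < \<delta>"
    by (rule LeastI_ex)
qed

end

text \<open>Rounding to \<open>D\<close> reduces the matter to functions with values in the
  naturals. Past level \<open>p\<close> the ancestor is the vertex at level \<open>p\<close>, so one
  approximation serves all later levels. The set \<open>D\<close> is a parameter because a scalar
  multiple of a fixed dense set will be inserted.\<close>

lemma (in boundary_prob) approximate_measurable:
  fixes \<psi> :: "'v set \<Rightarrow> 'e::metric_space"
  assumes "\<psi> \<in> borel_measurable (completion Q)" "0 < \<delta>" "countable D" "closure D = UNIV"
  obtains p c where "\<And>x. c x \<in> D"
    "\<And>m. p \<le> m \<Longrightarrow> measure (completion Q)
      {e \<in> space Q. \<delta> \<le> dist (\<psi> e) (c (ancestor p (vertex_at m e)))} < \<delta>"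
proof -
  interpret L: separable_L0 "completion Q" D
    by (intro separable_L0.intro prob_space_completion separable_L0_axioms.intro assms)
  have "D \<noteq> {}" using assms(4) by auto
  obtain s where s: "s \<in> completion Q \<rightarrow>\<^sub>M count_space UNIV"
    "\<And>x. dist (\<psi> x) (from_nat_into D (s x)) < \<delta>"
    using L.discretize[OF assms(1,2)] by blast
  obtain p c where pc: "measure (completion Q) {e \<in> space Q. s e \<noteq> c (vertex_at p e)} < \<delta>"
    using approximate_nat_valued[OF s(1) assms(2)] by blast
  show thesis
  proof (rule that[of "\<lambda>x. from_nat_into D (c x)" p])
    show "from_nat_into D (c x) \<in> D" for x using \<open>D \<noteq> {}\<close> by (rule from_nat_into)
    fix m assume "p \<le> m"
    have [measurable]: "(\<lambda>e. c (vertex_at p e)) \<in> completion Q \<rightarrow>\<^sub>M count_space UNIV"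
      by (rule measurable_compose[OF measurable_completion[OF vertex_at_measurable]]) simp
    note [measurable] = s(1)
    have [measurable]: "Measurable.pred (completion Q) (\<lambda>e. s e \<noteq> c (vertex_at p e))"
      by (rule measurable_compose_countable[where f = "\<lambda>i e. s e \<noteq> i"]) measurable
    have "{e \<in> space Q. \<delta> \<le> dist (\<psi> e) (from_nat_into D (c (ancestor p (vertex_at m e))))}
        \<subseteq> {e \<in> space (completion Q). s e \<noteq> c (vertex_at p e)}"
    proof
      fix e assume e: "e \<in> {e \<in> space Q. \<delta> \<le> dist (\<psi> e) (from_nat_into D (c (ancestor p (vertex_at m e))))}"
      then have "ancestor p (vertex_at m e) = vertex_at p e"
        using \<open>p \<le> m\<close> by (simp add: ancestor_vertex_at space_Q)
      with e s(2)[of e] show "e \<in> {e \<in> space (completion Q). s e \<noteq> c (vertex_at p e)}"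
        by auto
    qed
    then have "measure (completion Q)
        {e \<in> space Q. \<delta> \<le> dist (\<psi> e) (from_nat_into D (c (ancestor p (vertex_at m e))))}
      \<le> measure (completion Q) {e \<in> space (completion Q). s e \<noteq> c (vertex_at p e)}"
    proof (rule L.finite_measure_mono)
      show "{e \<in> space (completion Q). s e \<noteq> c (vertex_at p e)} \<in> sets (completion Q)"
        by measurable
    qed
    with pc show "measure (completion Q)
        {e \<in> space Q. \<delta> \<le> dist (\<psi> e) (from_nat_into D (c (ancestor p (vertex_at m e))))} < \<delta>"
      by simp
  qed
qed

section \<open>Upper density\<close>

text \<open>Such a block omits at most \<open>2 * fact n\<close> of the first
  \<open>fact (Suc n) = Suc n * fact n\<close> numbers, a proportion of at most
  \<open>2 / Suc n\<close>. The offset \<open>n\<close> leaves room for the levels in which a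
  harmonic function settles.\<close>

lemma upper_density_eq_1:
  fixes A :: "nat set"
  assumes "\<And>n0. \<exists>n\<ge>n0. {fact n + n..fact (Suc n)} \<subseteq> A"
  shows "upper_density A = 1"
proof (rule antisym)
  have "real (card (A \<inter> {1..N})) / real N \<le> 1" for N
  proof (cases "N = 0")
    case False
    have "card (A \<inter> {1..N}) \<le> card {1..N}" by (intro card_mono) auto
    with False show ?thesis by simp
  qed simp
  then show "upper_density A \<le> 1"
    unfolding upper_density_def by (intro Limsup_bounded) (simp add: one_ereal_def)
  show "1 \<le> upper_density A"
  proof (rule ccontr)
    assume "\<not> ?thesis"
    then have "upper_density A < 1" by simp
    from ereal_dense2[OF this] obtain c where c: "upper_density A < ereal c" "ereal c < 1" by blast
    from Limsup_lessD[OF c(1)[unfolded upper_density_def]]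
    obtain N0 where N0: "\<And>N. N0 \<le> N \<Longrightarrow> real (card (A \<inter> {1..N})) / real N < c"
      unfolding eventually_sequentially by auto
    have "c < 1" using c(2) by (simp add: one_ereal_def)
    \<comment> \<open>For \<open>n \<ge> n1\<close> the proportion \<open>2 / Suc n\<close> is below
      \<open>1 - c\<close>, which contradicts the bound \<open>c\<close> at
      \<open>N = fact (Suc n)\<close>.\<close>
    obtain n1 where n1: "2 / (1 - c) < real n1" using reals_Archimedean2 by blast
    obtain n where n: "max N0 n1 \<le> n" "{fact n + n..fact (Suc n)} \<subseteq> A" using assms by blast
    define N :: nat where "N = fact (Suc n)"
    have "Suc n \<le> N" unfolding N_def by (rule fact_ge_self)
    have "n \<le> fact n" by (rule fact_ge_self)
    have "1 \<le> (fact n + n :: nat)" by (rule trans_le_add1[OF fact_ge_1])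
    then have "{fact n + n..N} \<subseteq> {1..N}" unfolding atLeastatMost_subset_iff by blast
    with n(2) have "{fact n + n..N} \<subseteq> A \<inter> {1..N}" unfolding N_def by blast
    then have "card {fact n + n..N} \<le> card (A \<inter> {1..N})" by (intro card_mono) auto
    then have "N \<le> card (A \<inter> {1..N}) + 2 * fact n" using \<open>n \<le> fact n\<close> by simp
    then have "real N \<le> real (card (A \<inter> {1..N}) + 2 * fact n)" by (simp only: of_nat_le_iff)
    then have "real N \<le> real (card (A \<inter> {1..N})) + 2 * fact n" by simp
    then have "real N / real N \<le> (real (card (A \<inter> {1..N})) + 2 * fact n) / real N"
      by (rule divide_right_mono) simp
    then have "1 - 2 * fact n / real N \<le> real (card (A \<inter> {1..N})) / real N"
      using \<open>Suc n \<le> N\<close> by (simp add: add_divide_distrib)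
    moreover have "real N = real (Suc n) * fact n" by (simp add: N_def algebra_simps)
    ultimately have *: "1 - 2 / real (Suc n) \<le> real (card (A \<inter> {1..N})) / real N" by simp
    have "2 / (1 - c) < real (Suc n)" using n1 n(1) by simp
    then have "2 / real (Suc n) < 1 - c" using \<open>c < 1\<close> by (simp add: field_simps)
    with * N0[of N] \<open>Suc n \<le> N\<close> n(1) show False by simp
  qed
qed

section \<open>Harmonic functions with prescribed values\<close>

locale harmonic_tree = probability_tree adj r q
  for adj :: "'v \<Rightarrow> 'v \<Rightarrow> bool" and r :: 'v and q :: "'v \<Rightarrow> 'v \<Rightarrow> real" +
  fixes smul :: "'f::{field,metric_space,topological_ab_group_add,topological_semigroup_mult} \<Rightarrow>
      'e::{metric_space,topological_ab_group_add} \<Rightarrow> 'e"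
    and w :: "'v \<Rightarrow> 'v \<Rightarrow> 'f"
  assumes tvs: "separable_metrizable_tvs smul"
    and weights: "harmonic_weights adj r w"
begin

sublocale V: vector_space smul
  using tvs by (simp add: separable_metrizable_tvs_def)

abbreviation harmonics :: "('v \<Rightarrow> 'e) set" where
  "harmonics \<equiv> harmonic_functions adj r w smul"

lemma harmonics_iff: "f \<in> harmonics \<longleftrightarrow> (\<forall>x. f x = (\<Sum>y\<in>children adj r x. smul (w x y) (f y)))"
  unfolding harmonic_functions_def by (rule mem_Collect_eq)

lemma weight_nonzero: "y \<in> children adj r x \<Longrightarrow> w x y \<noteq> 0"
  using weights by (simp add: harmonic_weights_def)

lemma sum_weights: "(\<Sum>y\<in>children adj r x. w x y) = 1"
  using weights by (simp add: harmonic_weights_def)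

lemma continuous_on_smul: "continuous_on A f \<Longrightarrow> continuous_on A (\<lambda>x. smul a (f x))"
proof -
  assume f: "continuous_on A f"
  have "continuous_on UNIV (\<lambda>(a, x). smul a x)"
    using tvs by (simp add: separable_metrizable_tvs_def)
  from continuous_on_compose2[OF this, of A "\<lambda>x. (a, f x)"] f show ?thesis
    by (simp add: continuous_on_Pair)
qed

text \<open>Every \<open>x\<close> is the image of \<open>smul (inverse a) x\<close>, and continuity
  sends the closure of \<open>D\<close> into that of the image. This lets a nonzero coefficient be
  absorbed into the values of a step function.\<close>

lemma dense_smul_image:
  assumes "a \<noteq> 0" "closure D = UNIV"
  shows "closure (smul a ` D) = UNIV"
proof -
  have "smul a ` closure D \<subseteq> closure (smul a ` D)"
    by (intro image_closure_subset continuous_on_smul continuous_on_id) (auto simp: closure_subset)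
  moreover have "x \<in> smul a ` closure D" for x
    using assms by (auto intro!: image_eqI[of _ _ "smul (inverse a) x"])
  ultimately show ?thesis by blast
qed

text \<open>A function agreeing with \<open>\<tau>\<close> off the light children is harmonic for exactly one
  choice of its values on the light children.\<close>

definition follows :: "('v \<Rightarrow> 'e) \<Rightarrow> ('v \<Rightarrow> 'e) \<Rightarrow> bool" where
  "follows f \<tau> \<longleftrightarrow> f \<in> harmonics \<and> (\<forall>y. y \<notin> range light_child \<longrightarrow> f y = \<tau> y)"

lemma root_not_light: "r \<notin> range light_child"
proof
  assume "r \<in> range light_child"
  then obtain x where "r = light_child x" by blast
  with depth_child[OF light_child(1)[of x]] show False by simp
qed

lemma heavy_child_not_light:
  assumes "y \<in> children adj r x" "y \<noteq> light_child x"
  shows "y \<notin> range light_child"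
proof
  assume "y \<in> range light_child"
  then obtain z where "y = light_child z" by blast
  with parent_child[OF assms(1)] assms(2) show False by simp
qed

lemma follows_light_child:
  assumes "follows f \<tau>"
  shows "f (light_child x) = smul (inverse (w x (light_child x)))
    (f x - (\<Sum>y\<in>children adj r x - {light_child x}. smul (w x y) (\<tau> y)))"
proof -
  let ?b = "light_child x"
  have "f x = (\<Sum>y\<in>children adj r x. smul (w x y) (f y))"
    using assms unfolding follows_def harmonics_iff by blast
  also have "\<dots> = smul (w x ?b) (f ?b) + (\<Sum>y\<in>children adj r x - {?b}. smul (w x y) (f y))"
    by (intro sum.remove finite_children light_child)
  also have "(\<Sum>y\<in>children adj r x - {?b}. smul (w x y) (f y))
      = (\<Sum>y\<in>children adj r x - {?b}. smul (w x y) (\<tau> y))"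
    using assms heavy_child_not_light by (intro sum.cong) (auto simp: follows_def)
  finally have "f x - (\<Sum>y\<in>children adj r x - {?b}. smul (w x y) (\<tau> y)) = smul (w x ?b) (f ?b)"
    by simp
  then show ?thesis using weight_nonzero[OF light_child(1), of x] by simp
qed

lemma follows_unique:
  assumes "follows f \<tau>" "follows g \<tau>"
  shows "f = g"
proof
  show "f y = g y" for y
  proof (induction "depth y" arbitrary: y)
    case 0
    then have "y = r" by (simp add: depth_eq_0_iff)
    with assms root_not_light show ?case by (simp add: follows_def)
  next
    case (Suc n)
    show ?case
    proof (cases "y \<in> range light_child")
      case True
      then obtain x where x: "y = light_child x" by blast
      with Suc(2) depth_child[OF light_child(1)[of x]] have "f x = g x" by (intro Suc(1)) simp
      then show ?thesis
        unfolding x follows_light_child[OF assms(1)] follows_light_child[OF assms(2)] by simp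
    next
      case False
      with assms show ?thesis by (simp add: follows_def)
    qed
  qed
qed

section \<open>Existence and continuity of the harmonic extension\<close>

text \<open>The counter is meant to equal the depth of the vertex; both drop by one on passing to
  the parent. At 0 the vertex is then the root, which is not light.\<close>

primrec extension :: "('v \<Rightarrow> 'e) \<Rightarrow> nat \<Rightarrow> 'v \<Rightarrow> 'e" where
  "extension \<tau> 0 y = \<tau> y"
| "extension \<tau> (Suc n) y = (if y \<in> range light_child
     then smul (inverse (w (parent y) y)) (extension \<tau> n (parent y)
       - (\<Sum>z\<in>children adj r (parent y) - {y}. smul (w (parent y) z) (\<tau> z)))
     else \<tau> y)"

definition harm :: "('v \<Rightarrow> 'e) \<Rightarrow> 'v \<Rightarrow> 'e" where
  "harm \<tau> y = extension \<tau> (depth y) y"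

lemma harm_not_light: "y \<notin> range light_child \<Longrightarrow> harm \<tau> y = \<tau> y"
  by (cases "depth y") (simp_all add: harm_def)

lemma harm_light_child:
  "harm \<tau> (light_child x) = smul (inverse (w x (light_child x)))
    (harm \<tau> x - (\<Sum>y\<in>children adj r x - {light_child x}. smul (w x y) (\<tau> y)))"
  using depth_child[OF light_child(1)[of x]] by (simp add: harm_def)

lemma follows_harm: "follows (harm \<tau>) \<tau>"
proof -
  have "harm \<tau> x = (\<Sum>y\<in>children adj r x. smul (w x y) (harm \<tau> y))" for x
  proof -
    let ?b = "light_child x"
    have "(\<Sum>y\<in>children adj r x. smul (w x y) (harm \<tau> y))
      = smul (w x ?b) (harm \<tau> ?b) + (\<Sum>y\<in>children adj r x - {?b}. smul (w x y) (harm \<tau> y))"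
      by (intro sum.remove finite_children light_child)
    also have "(\<Sum>y\<in>children adj r x - {?b}. smul (w x y) (harm \<tau> y))
        = (\<Sum>y\<in>children adj r x - {?b}. smul (w x y) (\<tau> y))"
      using heavy_child_not_light by (intro sum.cong) (auto simp: harm_not_light)
    also have "smul (w x ?b) (harm \<tau> ?b)
        = harm \<tau> x - (\<Sum>y\<in>children adj r x - {?b}. smul (w x y) (\<tau> y))"
      unfolding harm_light_child using weight_nonzero[OF light_child(1), of x] by simp
    finally show ?thesis by simp
  qed
  then have "harm \<tau> \<in> harmonics" unfolding harmonics_iff by blast
  then show ?thesis by (simp add: follows_def harm_not_light)
qed

text \<open>Thus \<open>harm\<close> retracts all functions onto the harmonic ones. Being
  continuous, it carries a dense set of prescriptions to a dense set of harmonic functions.\<close>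

lemma harm_harmonic: "h \<in> harmonics \<Longrightarrow> harm h = h"
  by (rule follows_unique[OF follows_harm]) (simp add: follows_def)

text \<open>By induction on the depth, every single value is a finite expression in values of
  \<open>\<tau>\<close> built from sums, differences and fixed scalars. For pointwise convergence
  this is enough.\<close>

lemma continuous_on_harm: "continuous_on UNIV harm"
proof (rule continuous_on_coordinatewise_then_product)
  show "continuous_on UNIV (\<lambda>\<tau>. harm \<tau> y)" for y
  proof (induction "depth y" arbitrary: y)
    case 0
    then have "y = r" by (simp add: depth_eq_0_iff)
    then show ?case
      by (simp add: harm_not_light root_not_light continuous_on_product_coordinates)
  next
    case (Suc n)
    show ?case
    proof (cases "y \<in> range light_child")
      case True
      then obtain x where x: "y = light_child x" by blast
      with Suc(2) depth_child[OF light_child(1)[of x]] have "continuous_on UNIV (\<lambda>\<tau>. harm \<tau> x)"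
        by (intro Suc(1)) simp
      then show ?thesis
        unfolding x harm_light_child
        by (intro continuous_on_smul continuous_on_diff continuous_on_sum
            continuous_on_product_coordinates)
    next
      case False
      then show ?thesis by (simp add: harm_not_light continuous_on_product_coordinates)
    qed
  qed
qed

text \<open>Since the weights sum to 1, a harmonic function that has reached the value prescribed for all
  heavy children also takes it at the light child.\<close>

lemma follows_persist:
  assumes f: "follows f \<tau>" and x: "f x = a"
    and \<tau>: "\<And>y. y \<in> children adj r x \<Longrightarrow> \<tau> y = a" and y: "y \<in> children adj r x"
  shows "f y = a"
proof (cases "y = light_child x")
  case False
  with f y \<tau> heavy_child_not_light show ?thesis by (auto simp: follows_def)
next
  case True
  let ?b = "light_child x"
  have "(\<Sum>y\<in>children adj r x - {?b}. smul (w x y) (\<tau> y))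
      = (\<Sum>y\<in>children adj r x - {?b}. smul (w x y) a)"
    using \<tau> by (intro sum.cong) auto
  also have "\<dots> = smul (\<Sum>y\<in>children adj r x - {?b}. w x y) a"
    by (simp add: V.scale_sum_left)
  also have "(\<Sum>y\<in>children adj r x - {?b}. w x y) = 1 - w x ?b"
  proof -
    have "(\<Sum>y\<in>children adj r x. w x y) = w x ?b + (\<Sum>y\<in>children adj r x - {?b}. w x y)"
      by (intro sum.remove finite_children light_child)
    then show ?thesis by (simp add: sum_weights eq_diff_eq add.commute)
  qed
  finally have "f ?b = smul (inverse (w x ?b)) (a - smul (1 - w x ?b) a)"
    unfolding follows_light_child[OF f] x by simp
  also have "a - smul (1 - w x ?b) a = smul (w x ?b) a"
    by (simp add: V.scale_left_diff_distrib)
  finally show ?thesis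
    unfolding True using weight_nonzero[OF light_child(1), of x] by simp
qed

text \<open>Induction on \<open>k\<close>: a heavy child takes the prescribed value at once, and a
  light child takes it when its parent has done so. A new exception is therefore the light child of
  an old one.\<close>

lemma follows_off_light_descendants:
  assumes f: "follows f \<tau>" and v: "constant_below N v"
    and \<tau>: "\<And>y. N < depth y \<Longrightarrow> depth y \<le> M \<Longrightarrow> \<tau> y = v y"
    and "depth x = N + k" "N + k \<le> M" "x \<notin> (light_child ^^ k) ` level adj r N"
  shows "f x = v x"
  using assms(4-6)
proof (induction k arbitrary: x)
  case 0
  then show ?case by (simp add: level_def)
next
  case (Suc k)
  have "x \<in> children adj r (parent x)" using Suc.prems(1) by (intro child_parent) simp
  then obtain z where z: "x \<in> children adj r z" by blast
  then have dz: "depth z = N + k" using Suc.prems(1) by simp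
  have vz: "v y = v z" if "y \<in> children adj r z" for y
    using v that dz by (simp add: constant_below_def)
  have \<tau>z: "\<tau> y = v z" if "y \<in> children adj r z" for y
    using \<tau>[of y] vz[OF that] depth_child[OF that] dz Suc.prems(2) by simp
  show ?case
  proof (cases "x = light_child z")
    case True
    have "z \<notin> (light_child ^^ k) ` level adj r N"
      using Suc.prems(3) unfolding True by auto
    then have "f z = v z" using Suc.prems(2) dz by (intro Suc.IH) simp_all
    then have "f x = v z" by (rule follows_persist[OF f _ \<tau>z z])
    with vz[OF z] show ?thesis by simp
  next
    case False
    with z have "f x = \<tau> x"
      using f heavy_child_not_light by (auto simp: follows_def)
    with \<tau>z[OF z] vz[OF z] show ?thesis by simp
  qed
qed

text \<open>The harmonicity equation is linear, so a combination of generators can be treated as one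
  function following the combined prescription.\<close>

lemma follows_sum:
  assumes "\<And>i. i \<in> I \<Longrightarrow> follows (f i) (\<tau> i)"
  shows "follows (\<lambda>x. \<Sum>i\<in>I. smul (a i) (f i x)) (\<lambda>x. \<Sum>i\<in>I. smul (a i) (\<tau> i x))"
proof -
  have "(\<Sum>i\<in>I. smul (a i) (f i x)) = (\<Sum>y\<in>children adj r x. smul (w x y) (\<Sum>i\<in>I. smul (a i) (f i y)))"
    for x
  proof -
    have "(\<Sum>i\<in>I. smul (a i) (f i x))
        = (\<Sum>i\<in>I. smul (a i) (\<Sum>y\<in>children adj r x. smul (w x y) (f i y)))"
    proof (rule sum.cong[OF refl])
      fix i assume "i \<in> I"
      with assms have "f i \<in> harmonics" by (simp add: follows_def)
      then have "f i x = (\<Sum>y\<in>children adj r x. smul (w x y) (f i y))"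
        unfolding harmonics_iff by blast
      then show "smul (a i) (f i x) = smul (a i) (\<Sum>y\<in>children adj r x. smul (w x y) (f i y))"
        by simp
    qed
    also have "\<dots> = (\<Sum>i\<in>I. \<Sum>y\<in>children adj r x. smul (w x y) (smul (a i) (f i y)))"
      by (simp add: V.scale_sum_right mult.commute)
    also have "\<dots> = (\<Sum>y\<in>children adj r x. smul (w x y) (\<Sum>i\<in>I. smul (a i) (f i y)))"
      by (subst sum.swap) (simp add: V.scale_sum_right)
    finally show ?thesis .
  qed
  then have "(\<lambda>x. \<Sum>i\<in>I. smul (a i) (f i x)) \<in> harmonics" unfolding harmonics_iff by blast
  moreover have "(\<Sum>i\<in>I. smul (a i) (f i y)) = (\<Sum>i\<in>I. smul (a i) (\<tau> i y))"
    if "y \<notin> range light_child" for y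
    using assms that by (intro sum.cong) (auto simp: follows_def)
  ultimately show ?thesis by (simp add: follows_def)
qed

end

section \<open>The dense subspace\<close>

locale harmonic_boundary = boundary_prob adj r q Q + harmonic_tree adj r q smul w
  for adj :: "'v \<Rightarrow> 'v \<Rightarrow> bool" and r :: 'v and q :: "'v \<Rightarrow> 'v \<Rightarrow> real"
    and Q :: "'v set measure"
    and smul :: "'f::{field,metric_space,topological_ab_group_add,topological_semigroup_mult} \<Rightarrow>
      'e::{metric_space,topological_ab_group_add} \<Rightarrow> 'e"
    and w :: "'v \<Rightarrow> 'v \<Rightarrow> 'f" +
  fixes D :: "'e set"
  assumes countable_D: "countable D" and closure_D: "closure D = UNIV"
begin

section \<open>Step functions, stages and targets\<close>

text \<open>Using \<open>\<rightarrow>\<^sub>E\<close> on the finite set of vertices of depth at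
  most \<open>p\<close> keeps the family countable; \<open>ancestor p y\<close> always lies in that
  set.\<close>

definition step_functions :: "('v \<Rightarrow> 'e) set" where
  "step_functions = (\<Union>p. (\<lambda>c y. c (ancestor p y)) ` ({x. depth x \<le> p} \<rightarrow>\<^sub>E D))"

lemma countable_step_functions: "countable step_functions"
  unfolding step_functions_def
  by (intro countable_UN countable_image countable_PiE finite_depth_le countable_D) simp

lemma step_functionsI:
  assumes "\<And>x. c x \<in> D"
  shows "(\<lambda>y. c (ancestor p y)) \<in> step_functions"
proof -
  have "restrict c {x. depth x \<le> p} \<in> {x. depth x \<le> p} \<rightarrow>\<^sub>E D"
    using assms by auto
  moreover have "(\<lambda>y. c (ancestor p y)) = (\<lambda>y. restrict c {x. depth x \<le> p} (ancestor p y))"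
    by (simp add: depth_ancestor)
  ultimately show ?thesis unfolding step_functions_def by blast
qed

definition step :: "nat \<Rightarrow> 'v \<Rightarrow> 'e" where
  "step = from_nat_into step_functions"

lemma step_surj: "(\<And>x. c x \<in> D) \<Longrightarrow> \<exists>i. step i = (\<lambda>y. c (ancestor p y))"
  unfolding step_def by (intro from_nat_into_surj countable_step_functions step_functionsI)

text \<open>Stage \<open>n\<close> consists of the levels in \<open>{fact n<..fact (Suc n)}\<close>. Its task \<open>(k, i)\<close> steers the
  \<open>k\<close>-th generator to \<open>step i\<close> and all others to 0; every task recurs infinitely often.\<close>

definition stage :: "nat \<Rightarrow> nat" where
  "stage l = (LEAST n. l \<le> fact (Suc n))"

definition task :: "nat \<Rightarrow> nat \<times> nat" where
  "task n = prod_decode (fst (prod_decode n))"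

text \<open>The levels up to \<open>fact k\<close> serve density, the later stages universality. The
  second component of \<open>prod_decode k\<close> is padding: for a given step function it makes
  the initial segment as long as desired.\<close>

definition target :: "nat \<Rightarrow> 'v \<Rightarrow> 'e" where
  "target k y =
    (if depth y \<le> fact k then step (fst (prod_decode k)) y
     else if fst (task (stage (depth y))) = k then step (snd (task (stage (depth y)))) y
     else 0)"

lemma stage_eq: "fact n < l \<Longrightarrow> l \<le> fact (Suc n) \<Longrightarrow> stage l = n"
  unfolding stage_def
proof (rule Least_equality)
  fix m
  assume "fact n < l" "l \<le> fact (Suc m)"
  then have "(fact n :: nat) < fact (Suc m)" by (rule less_le_trans)
  then show "n \<le> m"
    using fact_mono[of "Suc m" n, where 'a = nat] by (meson not_less_eq_eq not_le)
qed

text \<open>The component discarded by \<open>task\<close> is set to \<open>n0\<close>, which makes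
  the code at least \<open>n0\<close>.\<close>

lemma ex_task: "\<exists>n\<ge>n0. task n = (k, i)"
  by (intro exI[of _ "prod_encode (prod_encode (k, i), n0)"])
    (simp add: task_def le_prod_encode_2)

lemma target_in_stage:
  assumes "k \<le> n" "fact n < depth y" "depth y \<le> fact (Suc n)"
  shows "target k y = (if fst (task n) = k then step (snd (task n)) y else 0)"
proof -
  have "(fact k :: nat) \<le> fact n" using assms(1) by (rule fact_mono)
  then have "\<not> depth y \<le> fact k" using assms(2) by linarith
  then show ?thesis using stage_eq[OF assms(2,3)] by (simp add: target_def)
qed

text \<open>A basic neighbourhood constrains finitely many vertices. Some function with values in
  \<open>D\<close> meets the constraints, and the step function with \<open>p\<close> bounding their
  depths agrees with it there.\<close>

lemma dense_targets: "closure (range target) = UNIV"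
proof -
  have "range target \<inter> A \<noteq> {}" if "open A" "h \<in> A" for A and h :: "'v \<Rightarrow> 'e"
  proof -
    from product_topology_open_contains_basis[OF that(1)[unfolded open_fun_def] that(2)]
    obtain X where X: "h \<in> (\<Pi>\<^sub>E i\<in>UNIV. X i)" "\<And>i. open (X i)"
      "finite {i. X i \<noteq> UNIV}" "(\<Pi>\<^sub>E i\<in>UNIV. X i) \<subseteq> A"
      by auto
    have "\<exists>d\<in>D. d \<in> X i" for i
    proof -
      have "h i \<in> closure D" by (simp add: closure_D)
      moreover have "h i \<in> X i" using X(1) by (simp add: PiE_iff)
      ultimately show ?thesis
        using X(2)[of i] open_Int_closure_eq_empty[of "X i" D] by blast
    qed
    then obtain c where c: "\<And>i. c i \<in> D" "\<And>i. c i \<in> X i" by metis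
    from X(3) obtain p where p: "\<And>i. X i \<noteq> UNIV \<Longrightarrow> depth i \<le> p"
      using finite_nat_set_iff_bounded_le[of "depth ` {i. X i \<noteq> UNIV}"] by auto
    obtain i where i: "step i = (\<lambda>y. c (ancestor p y))"
      using step_surj[of c p] c(1) by blast
    \<comment> \<open>The padding \<open>p\<close> forces \<open>?k \<ge> p\<close>, so the initial
      \<open>fact ?k\<close> levels contain all constrained vertices.\<close>
    let ?k = "prod_encode (i, p)"
    have "p \<le> ?k" by (rule le_prod_encode_2)
    also have "?k \<le> fact ?k" by (rule fact_ge_self)
    finally have pk: "p \<le> fact ?k" .
    have "target ?k y \<in> X y" for y
    proof (cases "X y = UNIV")
      case False
      with p have "depth y \<le> p" by blast
      with pk have "target ?k y = c y" by (simp add: target_def i ancestor_self)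
      with c show ?thesis by simp
    qed simp
    then have "target ?k \<in> A" using X(4) by (auto simp: PiE_iff)
    then show ?thesis by blast
  qed
  note * = this
  have "h \<in> closure (range target)" for h
    unfolding closure_iff_nhds_not_empty
  proof (intro allI impI)
    fix A S :: "('v \<Rightarrow> 'e) set"
    assume "S \<subseteq> A" "open S" "h \<in> S"
    with *[of S h] show "range target \<inter> A \<noteq> {}" by blast
  qed
  then show ?thesis by blast
qed

definition generator :: "nat \<Rightarrow> 'v \<Rightarrow> 'e" where
  "generator k = harm (target k)"

lemma dense_generators: "harmonics \<subseteq> closure (range generator)"
proof
  fix h assume "h \<in> harmonics"
  then have "h = harm h" by (simp add: harm_harmonic)
  then have "h \<in> harm ` closure (range target)" by (simp add: dense_targets)
  also have "\<dots> \<subseteq> closure (range generator)"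
  proof (rule image_closure_subset)
    show "continuous_on (closure (range target)) harm"
      using continuous_on_harm by (rule continuous_on_subset) simp
    show "harm ` range target \<subseteq> closure (range generator)"
      using closure_subset[of "range generator"] by (auto simp: generator_def)
  qed simp
  finally show "h \<in> closure (range generator)" .
qed

section \<open>Universality of linear combinations\<close>

lemma prob_exceptional_le:
  assumes f: "follows f \<tau>" and v: "constant_below N v"
    and \<tau>: "\<And>y. N < depth y \<Longrightarrow> depth y \<le> M \<Longrightarrow> \<tau> y = v y"
    and "N + k \<le> M"
  shows "prob {e \<in> space Q. f (vertex_at (N + k) e) \<noteq> v (vertex_at (N + k) e)} \<le> (1/2) ^ k"
proof -
  have "prob {e \<in> space Q. f (vertex_at (N + k) e) \<noteq> v (vertex_at (N + k) e)}
    \<le> prob {e \<in> space Q. vertex_at (N + k) e \<in> (light_child ^^ k) ` level adj r N}"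
  proof (rule finite_measure_mono)
    show "{e \<in> space Q. f (vertex_at (N + k) e) \<noteq> v (vertex_at (N + k) e)}
      \<subseteq> {e \<in> space Q. vertex_at (N + k) e \<in> (light_child ^^ k) ` level adj r N}"
    proof (rule subsetI, rule ccontr)
      fix e
      assume e: "e \<in> {e \<in> space Q. f (vertex_at (N + k) e) \<noteq> v (vertex_at (N + k) e)}"
        and "e \<notin> {e \<in> space Q. vertex_at (N + k) e \<in> (light_child ^^ k) ` level adj r N}"
      then have "vertex_at (N + k) e \<notin> (light_child ^^ k) ` level adj r N"
        "depth (vertex_at (N + k) e) = N + k" by (simp_all add: space_Q)
      from follows_off_light_descendants[OF f v \<tau> this(2) assms(4) this(1)] e show False by simp
    qed
    have "vertex_at (N + k) -` ((light_child ^^ k) ` level adj r N) \<inter> space Q \<in> sets Q"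
      by (rule measurable_sets[OF vertex_at_measurable]) simp
    also have "vertex_at (N + k) -` ((light_child ^^ k) ` level adj r N) \<inter> space Q
      = {e \<in> space Q. vertex_at (N + k) e \<in> (light_child ^^ k) ` level adj r N}" by auto
    finally show "{e \<in> space Q. vertex_at (N + k) e \<in> (light_child ^^ k) ` level adj r N} \<in> sets Q" .
  qed
  also have "\<dots> \<le> (1/2) ^ k" by (rule prob_light_descendants)
  finally show ?thesis .
qed

text \<open>In a late stage whose task names \<open>k j\<close>, the other summands are steered to
  0, so the combination is steered to \<open>a j\<close> times a step function. Such multiples
  approximate every measurable function.\<close>

lemma combination_universal:
  fixes a :: "'i \<Rightarrow> 'f" and k :: "'i \<Rightarrow> nat"
  assumes I: "finite I" "inj_on k I" and j: "j \<in> I" "a j \<noteq> 0"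
  defines "f \<equiv> \<lambda>x. \<Sum>i\<in>I. smul (a i) (generator (k i) x)"
  shows "f \<in> frequently_universal adj r w smul (completion Q)"
proof -
  interpret L: separable_L0 "completion Q" D
    by (intro separable_L0.intro prob_space_completion separable_L0_axioms.intro
        countable_D closure_D)
  define \<tau> where "\<tau> = (\<lambda>x. \<Sum>i\<in>I. smul (a i) (target (k i) x))"
  have f: "follows f \<tau>"
    unfolding f_def \<tau>_def by (intro follows_sum) (simp add: generator_def follows_harm)
  have "upper_density {n. 1 \<le> n \<and> L0_class (completion Q) (boundary_trace adj r n f) \<in> V} = 1"
    if V: "openin (L0_topology (completion Q)) V" "V \<noteq> {}" for V
  proof (rule upper_density_eq_1)
    fix n0
    obtain \<psi> \<delta> where \<psi>: "\<psi> \<in> borel_measurable (completion Q)" "0 < \<delta>"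
      and near: "\<And>\<phi>. \<phi> \<in> borel_measurable (completion Q) \<Longrightarrow>
        L.prob {x \<in> space (completion Q). \<delta> \<le> dist (\<psi> x) (\<phi> x)} < \<delta> \<Longrightarrow>
        L0_class (completion Q) \<phi> \<in> V"
      using L.openin_L0_topology_in_probability[OF V] by blast
    from \<psi>(2) have "0 < \<delta>/2" by simp
    \<comment> \<open>The values are taken in the image of \<open>D\<close> under
      \<open>smul (a j)\<close>: factoring out \<open>a j\<close> then leaves values in
      \<open>D\<close>, hence an enumerated step function.\<close>
    obtain p c where c: "\<And>x. c x \<in> smul (a j) ` D"
      and pc: "\<And>m. p \<le> m \<Longrightarrow>
        L.prob {e \<in> space Q. \<delta>/2 \<le> dist (\<psi> e) (c (ancestor p (vertex_at m e)))} < \<delta>/2"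
      by (rule approximate_measurable[OF \<psi>(1) \<open>0 < \<delta>/2\<close> countable_image[OF countable_D]
          dense_smul_image[OF j(2) closure_D]]) (rule that)
    from c have "\<exists>d. d \<in> D \<and> c x = smul (a j) d" for x by blast
    then obtain c' where c': "\<And>x. c' x \<in> D" "\<And>x. c x = smul (a j) (c' x)" by metis
    obtain i where i: "step i = (\<lambda>y. c' (ancestor p y))"
      using step_surj[of c' p] c'(1) by blast
    define v where "v y = c (ancestor p y)" for y
    obtain n1 where n1: "(1/2 :: real) ^ n1 < \<delta>/2"
      using real_arch_pow_inv[OF \<open>0 < \<delta>/2\<close>, of "1/2"] by auto
    from I(1) obtain n2 where n2: "\<And>i. i \<in> I \<Longrightarrow> k i \<le> n2"
      using finite_nat_set_iff_bounded_le[of "k ` I"] by auto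
    \<comment> \<open>Here \<open>n0\<close> gives arbitrarily late stages, \<open>n1\<close> a
      small exceptional set, \<open>n2\<close> the end of the initial segments of all generators
      involved, and \<open>p\<close> the constancy of \<open>v\<close> before the stage
      begins.\<close>
    obtain n where n: "Max {n0, n1, n2, p} \<le> n" "task n = (k j, i)" using ex_task by blast
    then have le: "n0 \<le> n" "n1 \<le> n" "n2 \<le> n" "p \<le> n" by auto
    have "n \<le> fact n" by (rule fact_ge_self)
    have \<tau>v: "\<tau> y = v y" if "fact n < depth y" "depth y \<le> fact (Suc n)" for y
    proof -
      have "\<tau> y = (\<Sum>i\<in>I. if i = j then v y else 0)"
        unfolding \<tau>_def
      proof (rule sum.cong[OF refl])
        fix l assume l: "l \<in> I"
        \<comment> \<open>Injectivity of \<open>k\<close> ensures that the task names the summand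
          \<open>j\<close> alone.\<close>
        have "target (k l) y = (if l = j then c' (ancestor p y) else 0)"
          using target_in_stage[of "k l" n y] n2[OF l] le(3) that l j(1) I(2) n(2)
          by (auto simp: i inj_on_def)
        then show "smul (a l) (target (k l) y) = (if l = j then v y else 0)"
          by (simp add: v_def c'(2))
      qed
      also have "\<dots> = v y" using I(1) j(1) by simp
      finally show ?thesis .
    qed
    have v: "constant_below (fact n) v"
      unfolding v_def using constant_below_ancestor le(4) \<open>n \<le> fact n\<close>
      by (rule constant_below_mono[OF _ order_trans])
    have "L0_class (completion Q) (boundary_trace adj r l f) \<in> V" if l: "l \<in> {fact n + n..fact (Suc n)}" for l
    proof (rule near)
      have trace: "boundary_trace adj r l g \<in> borel_measurable (completion Q)" for g :: "'v \<Rightarrow> 'e"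
        by (intro measurable_completion boundary_trace_measurable)
      show "boundary_trace adj r l f \<in> borel_measurable (completion Q)" by (rule trace)
      let ?A = "{e \<in> space (completion Q). \<delta>/2 \<le> dist (\<psi> e) (boundary_trace adj r l v e)}"
      let ?B = "{e \<in> space Q. f (vertex_at l e) \<noteq> v (vertex_at l e)}"
      \<comment> \<open>Level \<open>l\<close> lies \<open>m \<ge> n\<close> levels into the stage,
        enough for the exceptional mass to fall below \<open>\<delta>/2\<close>.\<close>
      obtain m where m: "l = fact n + m" "n \<le> m" "fact n + m \<le> fact (Suc n)"
        using l by (metis atLeastAtMost_iff le_add1 le_Suc_ex nat_add_left_cancel_le order_trans)
      have "prob ?B \<le> (1/2) ^ m"
        unfolding m(1) by (rule prob_exceptional_le[OF f v \<tau>v m(3)])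
      also have "\<dots> \<le> (1/2) ^ n1" using le(2) m(2) by (intro power_decreasing) auto
      finally have B: "prob ?B < \<delta>/2" using n1 by simp
      have "vertex_at l -` {x. f x \<noteq> v x} \<inter> space Q \<in> sets Q"
        by (rule measurable_sets[OF vertex_at_measurable]) simp
      moreover have "vertex_at l -` {x. f x \<noteq> v x} \<inter> space Q = ?B" by auto
      ultimately have B_sets: "?B \<in> sets Q" by simp
      have A_sets: "?A \<in> sets (completion Q)"
      proof -
        note [measurable] = L.dist_measurable[OF \<psi>(1) trace[of v]]
        show ?thesis by measurable
      qed
      have "p \<le> l" using le(4) \<open>n \<le> fact n\<close> m(1) by simp
      then have A: "L.prob ?A < \<delta>/2"
        using pc[of l] by (simp add: boundary_trace_eq v_def)
      \<comment> \<open>Off \<open>?B\<close> the traces of \<open>f\<close> and \<open>v\<close>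
        agree, and off \<open>?A\<close> the trace of \<open>v\<close> is within
        \<open>\<delta>/2\<close> of \<psi>.\<close>
      have "{e \<in> space (completion Q). \<delta> \<le> dist (\<psi> e) (boundary_trace adj r l f e)} \<subseteq> ?A \<union> ?B"
        using \<psi>(2) by (auto simp: boundary_trace_eq)
      moreover have "?A \<union> ?B \<in> sets (completion Q)"
        by (rule sets.Un[OF A_sets sets_completionI_sets[OF B_sets]])
      ultimately have "L.prob {e \<in> space (completion Q). \<delta> \<le> dist (\<psi> e) (boundary_trace adj r l f e)}
          \<le> L.prob (?A \<union> ?B)"
        by (rule L.finite_measure_mono)
      also have "\<dots> \<le> L.prob ?A + L.prob ?B"
        by (rule measure_Un_le[OF A_sets sets_completionI_sets[OF B_sets]])
      also have "\<dots> < \<delta>" using A B measure_completion[OF B_sets] by simp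
      finally show "L.prob {e \<in> space (completion Q). \<delta> \<le> dist (\<psi> e) (boundary_trace adj r l f e)} < \<delta>" .
    qed
    moreover have "1 \<le> l" if "l \<in> {fact n + n..fact (Suc n)}" for l
    proof -
      have "1 \<le> (fact n + n :: nat)" by (rule trans_le_add1[OF fact_ge_1])
      also have "\<dots> \<le> l" using that by (simp only: atLeastAtMost_iff)
      finally show ?thesis .
    qed
    ultimately have "{fact n + n..fact (Suc n)}
        \<subseteq> {n. 1 \<le> n \<and> L0_class (completion Q) (boundary_trace adj r n f) \<in> V}" by blast
    with le(1) show "\<exists>n\<ge>n0. {fact n + n..fact (Suc n)}
        \<subseteq> {n. 1 \<le> n \<and> L0_class (completion Q) (boundary_trace adj r n f) \<in> V}" by blast
  qed
  with f show ?thesis by (simp add: frequently_universal_def follows_def)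
qed

section \<open>The span of the generators\<close>

lemma module_pointwise: "module (\<lambda>a (f :: 'v \<Rightarrow> 'e) x. smul a (f x))"
  by unfold_locales
    (auto simp: fun_eq_iff V.scale_right_distrib V.scale_left_distrib)

text \<open>The span of the generators works: a combination with a nonzero coefficient is universal,
  any other one is 0, and density is inherited from the generators.\<close>

lemma ex_dense_subspace:
  "\<exists>L. module.subspace (\<lambda>a (f :: 'v \<Rightarrow> 'e) x. smul a (f x)) L \<and>
    L \<subseteq> harmonics \<and>
    L \<subseteq> frequently_universal adj r w smul (completion Q) \<union> {0} \<and>
    harmonics \<subseteq> closure L"
proof -
  interpret M: module "\<lambda>a (f :: 'v \<Rightarrow> 'e) x. smul a (f x)" by (rule module_pointwise)
  have zero: "(0 :: 'v \<Rightarrow> 'e) \<in> harmonics"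
    unfolding harmonics_iff by simp
  have sum_apply: "(\<Sum>g\<in>t. F g) x = (\<Sum>g\<in>t. F g x)"
    for t :: "('v \<Rightarrow> 'e) set" and F :: "('v \<Rightarrow> 'e) \<Rightarrow> 'v \<Rightarrow> 'e" and x
    by (induction t rule: infinite_finite_induct) auto
  have L: "f \<in> frequently_universal adj r w smul (completion Q) \<union> {0}"
    if "f \<in> M.span (range generator)" for f
  proof -
    from that obtain t a where t: "finite t" "t \<subseteq> range generator"
      and f: "f = (\<Sum>g\<in>t. (\<lambda>x. smul (a g) (g x)))"
      unfolding M.span_explicit by blast
    \<comment> \<open>Elements of the span are sums over distinct functions, while universality is
      stated for indices. One index per function gives a map injective on \<open>t\<close>, even if
      \<open>generator\<close> repeats values.\<close>
    define k where "k = inv generator"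
    have gen: "generator (k g) = g" if "g \<in> t" for g
      using that t(2) unfolding k_def by (intro f_inv_into_f) blast
    then have inj: "inj_on k t" by (metis inj_onI)
    have f': "f = (\<lambda>x. \<Sum>g\<in>t. smul (a g) (generator (k g) x))"
      unfolding f by (simp add: fun_eq_iff sum_apply gen)
    show ?thesis
    proof (cases "\<exists>g\<in>t. a g \<noteq> 0")
      case True
      with combination_universal[OF t(1) inj] show ?thesis unfolding f' by blast
    next
      case False
      then have "f = 0" unfolding f by (simp add: fun_eq_iff sum_apply)
      then show ?thesis by simp
    qed
  qed
  moreover have "M.span (range generator) \<subseteq> harmonics"
    using L zero by (auto simp: frequently_universal_def)
  moreover have "harmonics \<subseteq> closure (M.span (range generator))"
    using dense_generators closure_mono[OF M.span_superset] by blast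
  ultimately show ?thesis using M.subspace_span[of "range generator"] by blast
qed

end

theorem theorem3p7:
  fixes adj :: "'v \<Rightarrow> 'v \<Rightarrow> bool" and x\<^sub>0 :: 'v and q :: "'v \<Rightarrow> 'v \<Rightarrow> real"
    and P :: "'v set measure"
    and smul :: "'f::{field,metric_space,topological_ab_group_add,topological_semigroup_mult} \<Rightarrow>
      'e::{metric_space,topological_ab_group_add} \<Rightarrow> 'e"
    and w :: "'v \<Rightarrow> 'v \<Rightarrow> 'f"
  assumes "transition_tree adj x\<^sub>0 q"
    and "boundary_measure adj x\<^sub>0 q P"
    and "separable_metrizable_tvs smul"
    and "harmonic_weights adj x\<^sub>0 w"
  shows "\<exists>L. module.subspace (\<lambda>a (f :: 'v \<Rightarrow> 'e) x. smul a (f x)) L \<and>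
    L \<subseteq> harmonic_functions adj x\<^sub>0 w smul \<and>
    L \<subseteq> frequently_universal adj x\<^sub>0 w smul P \<union> {0} \<and>
    harmonic_functions adj x\<^sub>0 w smul \<subseteq> closure L"
proof -
  from assms(2) obtain Q where Q: "P = completion Q" "prob_space Q"
    "space Q = boundary adj x\<^sub>0"
    "sets Q = sigma_sets (boundary adj x\<^sub>0) (\<Union>n\<in>{1..}. level_algebra adj x\<^sub>0 n)"
    "\<And>n y. 1 \<le> n \<Longrightarrow> y 0 = x\<^sub>0 \<Longrightarrow> (\<And>j. j < n \<Longrightarrow> y (Suc j) \<in> children adj x\<^sub>0 (y j)) \<Longrightarrow>
      measure Q (cylinder adj x\<^sub>0 (y n)) = (\<Prod>j<n. q (y j) (y (Suc j)))"
    unfolding boundary_measure_def by blast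
  from assms(3) obtain D :: "'e set" where D: "countable D" "closure D = UNIV"
    by (auto simp: separable_metrizable_tvs_def separable_space_def)
  have "tree adj" using assms(1) by (simp add: transition_tree_def)
  then have prob_tree: "probability_tree adj x\<^sub>0 q"
    using assms(1) by (intro probability_tree.intro probability_tree_axioms.intro rooted_tree.intro)
  have "boundary_prob adj x\<^sub>0 q Q"
  proof (intro boundary_prob.intro boundary_prob_axioms.intro prob_tree Q(2-4))
    fix n and y :: "nat \<Rightarrow> 'v"
    assume "1 \<le> n" "y 0 = x\<^sub>0" "\<And>j. j < n \<Longrightarrow> y (Suc j) \<in> children adj x\<^sub>0 (y j)"
    then show "measure Q (cylinder adj x\<^sub>0 (y n)) = (\<Prod>j<n. q (y j) (y (Suc j)))"
      by (rule Q(5))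
  qed
  moreover have "harmonic_tree adj x\<^sub>0 q smul w"
    by (intro harmonic_tree.intro harmonic_tree_axioms.intro prob_tree assms(3,4))
  ultimately interpret harmonic_boundary adj x\<^sub>0 q Q smul w D
    by (intro harmonic_boundary.intro harmonic_boundary_axioms.intro D)
  show ?thesis unfolding Q(1) by (rule ex_dense_subspace)
qed

end
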